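(* For positive integers $q$, $$ F_\mathcal{L}(q,\mathbf{v})= q^{-\mathrm{rk}(G)}\frac {|qG_t|}{m(\emptyset)}\left( \prod_{e \in E}v_e \right)Z_\mathcal{L}^P(q, q/\mathbf{v}), $$ where $q/\mathbf{v} := \{q/v_e\}_{e \in E}$. Moreover, (1) if $q \in \mathbb{Z}_M(\mathcal{L})$, then $F_\mathcal{L}(q,\mathbf{v})= \left( \prod_{e \in E}v_e \right)Z_{\mathcal{M}_\mathcal{L}}(q, q/\mathbf{v})$; (2) if $q \in \mathbb{Z}_A(\mathcal{L})$, then $F_\mathcal{L}(q,\mathbf{v})= \frac {1}{m(\emptyset)} \left( \prod_{e \in E}v_e \right)Z_{\mathcal{A}_\mathcal{L}}(q, q/\mathbf{v})$.
   Context: Let $\mathcal{L}=(g_e)_{e \in E}$ be a finite list of elements of a finitely generated abelian group $G$, with torsion subgroup $G_t$. For $A\subseteq E$, let $\mathcal{L}_A=(g_e)_{e\in A}$, $\mathrm{rk}(A)$ the rank of $\langle\mathcal{L}_A\rangle$, $G_A$ the torsion subgroup of $G/\langle \mathcal{L}_A\rangle$, $m(A):=|G_A|$. Let $\mathcal{M}_\mathcal{L}$ be the matroid with rank function $\mathrm{rk}$ and $\mathcal{A}_\mathcal{L}$ the arithmetic matroid with rank $\mathrm{rk}$ and multiplicity $m$; $Z_{\mathcal{M}_\mathcal{L}}(q,\mathbf{v}) = \sum_{A} q^{-\mathrm{rk}(A)}\prod_{e\in A}v_e$ and $Z_{\mathcal{A}_\mathcal{L}}(q,\mathbf{v}) =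 \sum_{A} m(A)q^{-\mathrm{rk}(A)}\prod_{e\in A}v_e$. Let $Z_\mathcal{L}^P(q,\mathbf{v}) := \sum_{\phi \in \mathrm{Hom}(G, \mathbb{Z}/q\mathbb{Z})} \prod_{e \in E}(1+v_{e}\delta(\phi(g_e),0))$. Define $\Psi_E^q : (\mathbb{Z}/q\mathbb{Z})^E \rightarrow G/qG$ by $\Psi_E^q(\phi) = \sum_{e \in E} \phi(e)g_e + qG$, and the multivariate arithmetic flow polynomial $F_\mathcal{L}(q,\mathbf{v}):= \sum_{\phi \in \ker(\Psi_E^q)} \prod_{e \in E} (1 +v_e \delta(\phi(e),0))$. Let $N$ be the least common multiple of $m(B)$ over all bases $B\subseteq E$; $\mathbb{Z}_M(\mathcal{L}) := \{q \in \mathbb{Z}_{>0} : \gcd(q, N)=1\}$ and $\mathbb{Z}_A(\mathcal{L}) := \{q \in \mathbb{Z}_{>0} : qG_B=(0) \text{ for all bases } B\}$. *)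

theory Defs
  imports "HOL-Algebra.Algebra"
begin

text \<open>
  Abelian groups are HOL-Algebra groups, hence written multiplicatively: \<open>x [^] n\<close> is the
  multiple \<open>nx\<close> and \<open>finprod\<close> is a sum in the group. The list \<open>(g\<^sub>e)\<^sub>e\<^sub>\<in>\<^sub>E\<close> is a function \<open>g\<close> on a
  finite index set \<open>E\<close>, so repetitions are allowed.
\<close>

section \<open>Abelian groups\<close>

definition finitely_generated :: "('g, 'b) monoid_scheme \<Rightarrow> bool" where
  "finitely_generated G \<longleftrightarrow>
     (\<exists>S. finite S \<and> S \<subseteq> carrier G \<and> generate G S = carrier G)"

definition torsion :: "('g, 'b) monoid_scheme \<Rightarrow> 'g set" where
  "torsion G = {x \<in> carrier G. \<exists>n::nat. n > 0 \<and> x [^]\<^bsub>G\<^esub> n = \<one>\<^bsub>G\<^esub>}"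

text \<open>\<open>multiples G q H\<close> is the set written \<open>qH\<close> in additive notation.\<close>

definition multiples :: "('g, 'b) monoid_scheme \<Rightarrow> nat \<Rightarrow> 'g set \<Rightarrow> 'g set" where
  "multiples G q H = (\<lambda>x. x [^]\<^bsub>G\<^esub> q) ` H"

definition Z_independent :: "('g, 'b) monoid_scheme \<Rightarrow> 'g set \<Rightarrow> bool" where
  "Z_independent G S \<longleftrightarrow> finite S \<and> S \<subseteq> carrier G \<and>
     (\<forall>c :: 'g \<Rightarrow> int.
        finprod G (\<lambda>x. x [^]\<^bsub>G\<^esub> c x) S = \<one>\<^bsub>G\<^esub> \<longrightarrow> (\<forall>x\<in>S. c x = 0))"

text \<open>
  The rank of a subgroup \<open>H\<close> of \<open>G\<close> is the maximal size of a \<open>\<int>\<close>-linearly independent subset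
  of \<open>H\<close>. The sizes are bounded when \<open>H\<close> is finitely generated, the only case used here;
  otherwise \<open>Max\<close> may carry no information.
\<close>

definition group_rank :: "('g, 'b) monoid_scheme \<Rightarrow> 'g set \<Rightarrow> nat" where
  "group_rank G H = Max {card S | S. S \<subseteq> H \<and> Z_independent G S}"

text \<open>
  \<open>hom\<close> does not constrain functions outside the carrier; restricting to extensional functions
  makes elements of this set correspond bijectively to homomorphisms, so that one can sum over it.
\<close>

definition Hom_set :: "('g, 'b) monoid_scheme \<Rightarrow> ('h, 'c) monoid_scheme \<Rightarrow> ('g \<Rightarrow> 'h) set" where
  "Hom_set G H = hom G H \<inter> extensional (carrier G)"

section \<open>Matroids and arithmetic matroids\<close>

text \<open>
  A matroid is given by its ground set \<open>E\<close> and rank function \<open>r\<close>, an arithmetic matroid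
  by an additional multiplicity function \<open>m\<close>.
\<close>

definition mat_indep :: "'e set \<Rightarrow> ('e set \<Rightarrow> nat) \<Rightarrow> 'e set \<Rightarrow> bool" where
  "mat_indep E r A \<longleftrightarrow> A \<subseteq> E \<and> r A = card A"

definition mat_bases :: "'e set \<Rightarrow> ('e set \<Rightarrow> nat) \<Rightarrow> 'e set set" where
  "mat_bases E r = {B. mat_indep E r B \<and> (\<forall>C. mat_indep E r C \<and> B \<subseteq> C \<longrightarrow> C = B)}"

definition Z_matroid ::
    "'e set \<Rightarrow> ('e set \<Rightarrow> nat) \<Rightarrow> 'k \<Rightarrow> ('e \<Rightarrow> 'k) \<Rightarrow> 'k::field_char_0" where
  "Z_matroid E r q v = (\<Sum>A\<in>Pow E. q powi (- int (r A)) * (\<Prod>e\<in>A. v e))"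

definition Z_arith_matroid ::
    "'e set \<Rightarrow> ('e set \<Rightarrow> nat) \<Rightarrow> ('e set \<Rightarrow> nat) \<Rightarrow> 'k \<Rightarrow> ('e \<Rightarrow> 'k) \<Rightarrow> 'k::field_char_0" where
  "Z_arith_matroid E r m q v =
     (\<Sum>A\<in>Pow E. of_nat (m A) * q powi (- int (r A)) * (\<Prod>e\<in>A. v e))"

section \<open>The data attached to a list of group elements\<close>

definition list_span :: "('g, 'b) monoid_scheme \<Rightarrow> ('e \<Rightarrow> 'g) \<Rightarrow> 'e set \<Rightarrow> 'g set" where
  "list_span G g A = generate G (g ` A)"

definition list_rk :: "('g, 'b) monoid_scheme \<Rightarrow> ('e \<Rightarrow> 'g) \<Rightarrow> 'e set \<Rightarrow> nat" where
  "list_rk G g A = group_rank G (list_span G g A)"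

text \<open>The group \<open>G\<^sub>A\<close>, as a subset of the carrier of \<open>G / \<langle>\<L>\<^sub>A\<rangle>\<close>.\<close>

definition list_torsion :: "('g, 'b) monoid_scheme \<Rightarrow> ('e \<Rightarrow> 'g) \<Rightarrow> 'e set \<Rightarrow> 'g set set" where
  "list_torsion G g A = torsion (G Mod list_span G g A)"

definition list_mult :: "('g, 'b) monoid_scheme \<Rightarrow> ('e \<Rightarrow> 'g) \<Rightarrow> 'e set \<Rightarrow> nat" where
  "list_mult G g A = card (list_torsion G g A)"

definition list_bases :: "('g, 'b) monoid_scheme \<Rightarrow> 'e set \<Rightarrow> ('e \<Rightarrow> 'g) \<Rightarrow> 'e set set" where
  "list_bases G E g = mat_bases E (list_rk G g)"

definition ZM_set :: "('g, 'b) monoid_scheme \<Rightarrow> 'e set \<Rightarrow> ('e \<Rightarrow> 'g) \<Rightarrow> nat set" where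
  "ZM_set G E g = {q. q > 0 \<and> gcd q (Lcm (list_mult G g ` list_bases G E g)) = 1}"

definition ZA_set :: "('g, 'b) monoid_scheme \<Rightarrow> 'e set \<Rightarrow> ('e \<Rightarrow> 'g) \<Rightarrow> nat set" where
  "ZA_set G E g =
     {q. q > 0 \<and> (\<forall>B\<in>list_bases G E g.
        multiples (G Mod list_span G g B) q (list_torsion G g B) = {\<one>\<^bsub>G Mod list_span G g B\<^esub>})}"

section \<open>The polynomials \<open>Z\<^sup>P\<close> and \<open>F\<close>\<close>

definition Z_Potts ::
    "('g, 'b) monoid_scheme \<Rightarrow> 'e set \<Rightarrow> ('e \<Rightarrow> 'g) \<Rightarrow> nat \<Rightarrow> ('e \<Rightarrow> 'k) \<Rightarrow> 'k::field_char_0" where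
  "Z_Potts G E g q v =
     (\<Sum>\<phi>\<in>Hom_set G (integer_mod_group q). \<Prod>e\<in>E. 1 + v e * of_bool (\<phi> (g e) = 0))"

text \<open>
  Elements of \<open>\<int>/q\<int>\<close> are represented by \<open>0, \<dots>, q - 1\<close>; since the values of \<open>\<Psi>\<close> are taken modulo
  \<open>qG\<close>, the choice of representatives is immaterial.
\<close>

definition Psi ::
    "('g, 'b) monoid_scheme \<Rightarrow> 'e set \<Rightarrow> ('e \<Rightarrow> 'g) \<Rightarrow> nat \<Rightarrow> ('e \<Rightarrow> int) \<Rightarrow> 'g set" where
  "Psi G E g q \<phi> =
     multiples G q (carrier G) #>\<^bsub>G\<^esub> finprod G (\<lambda>e. g e [^]\<^bsub>G\<^esub> \<phi> e) E"

definition flow_poly ::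
    "('g, 'b) monoid_scheme \<Rightarrow> 'e set \<Rightarrow> ('e \<Rightarrow> 'g) \<Rightarrow> nat \<Rightarrow> ('e \<Rightarrow> 'k) \<Rightarrow> 'k::field_char_0" where
  "flow_poly G E g q v =
     (\<Sum>\<phi>\<in>kernel (product_group E (\<lambda>_. integer_mod_group q))
                 (G Mod multiples G q (carrier G)) (Psi G E g q).
        \<Prod>e\<in>E. 1 + v e * of_bool (\<phi> e = 0))"

end

theory Submission
  imports Defs
begin

text \<open>
  Expanding the products reduces everything to three numbers attached to \<open>A \<subseteq> E\<close>: the number
  \<open>|W\<^sub>A|\<close> of elements of \<open>ker \<Psi>\<close> supported on \<open>A\<close>, the number of homomorphisms \<open>G \<rightarrow> \<int>/q\<close> that
  vanish on \<open>\<L>\<^sub>A\<close>, and the index \<open>i\<^sub>A = [G : \<langle>\<L>\<^sub>A\<rangle> + qG]\<close>. Duality over \<open>\<int>/q\<close> identifies the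
  second with \<open>i\<^sub>A\<close>, and counting cosets gives \<open>|W\<^sub>A| [G : qG] = q\<^bsup>|A|\<^esup> i\<^sub>A\<close>; this yields the
  formula with \<open>Z\<^sup>P\<close> up to the factor \<open>[G : qG]\<close>. For a finitely generated abelian group \<open>K\<close> one has
  \<open>[K : qK] = q\<^bsup>rk K\<^esup> |K[q]|\<close>, where \<open>K[q]\<close> is the \<open>q\<close>-torsion. Applied to \<open>K = G\<close> this evaluates
  \<open>[G : qG]\<close>, and applied to \<open>K = G / \<langle>\<L>\<^sub>A\<rangle>\<close> it evaluates \<open>i\<^sub>A\<close>. Finally \<open>K[q]\<close> is trivial for
  \<open>q \<in> \<int>\<^sub>M\<close> and the whole torsion subgroup \<open>G\<^sub>A\<close> for \<open>q \<in> \<int>\<^sub>A\<close>, because the torsion of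
  \<open>G / \<langle>\<L>\<^sub>A\<rangle>\<close> is controlled by that of \<open>G / \<langle>\<L>\<^sub>B\<rangle>\<close> for a basis \<open>B\<close> that contains a basis of \<open>A\<close>.
\<close>

section \<open>Integer linear combinations\<close>

definition lincomb :: "('g, 'b) monoid_scheme \<Rightarrow> ('i \<Rightarrow> 'g) \<Rightarrow> 'i set \<Rightarrow> ('i \<Rightarrow> int) \<Rightarrow> 'g" where
  "lincomb G x J c = finprod G (\<lambda>j. x j [^]\<^bsub>G\<^esub> c j) J"

text \<open>Independence is phrased for indexed families because the list may repeat elements: equal
  elements at two indices must count as dependent. It also lets images of elements in a quotient be
  handled before they are known to be distinct.\<close>

definition independent_family :: "('g, 'b) monoid_scheme \<Rightarrow> ('i \<Rightarrow> 'g) \<Rightarrow> 'i set \<Rightarrow> bool" where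
  "independent_family G x J \<longleftrightarrow> finite J \<and> x ` J \<subseteq> carrier G \<and>
     (\<forall>c. lincomb G x J c = \<one>\<^bsub>G\<^esub> \<longrightarrow> (\<forall>j\<in>J. c j = 0))"

lemma Z_independent_iff_family: "Z_independent G S \<longleftrightarrow> independent_family G (\<lambda>s. s) S"
  by (auto simp: Z_independent_def independent_family_def lincomb_def)

lemma (in comm_group) lincomb_cong:
  assumes "\<And>j. j \<in> J \<Longrightarrow> x j = y j" "\<And>j. j \<in> J \<Longrightarrow> c j = d j" "y ` J \<subseteq> carrier G"
  shows "lincomb G x J c = lincomb G y J d"
  unfolding lincomb_def using assms by (intro finprod_cong') auto

lemma (in comm_group) lincomb_closed [simp]:
  assumes "x ` J \<subseteq> carrier G"
  shows "lincomb G x J c \<in> carrier G"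
  unfolding lincomb_def using assms by (auto intro!: finprod_closed)

lemma (in comm_group) lincomb_zero:
  assumes "\<And>j. j \<in> J \<Longrightarrow> c j = 0"
  shows "lincomb G x J c = \<one>"
  unfolding lincomb_def using assms by (intro finprod_one_eqI) auto

lemma (in comm_group) lincomb_add:
  assumes "x ` J \<subseteq> carrier G"
  shows "lincomb G x J (\<lambda>j. c j + d j) = lincomb G x J c \<otimes> lincomb G x J d"
proof -
  have "lincomb G x J (\<lambda>j. c j + d j) = finprod G (\<lambda>j. x j [^] c j \<otimes> x j [^] d j) J"
    unfolding lincomb_def using assms by (intro finprod_cong') (auto simp: int_pow_mult)
  also have "\<dots> = lincomb G x J c \<otimes> lincomb G x J d"
    unfolding lincomb_def using assms by (intro finprod_multf) auto
  finally show ?thesis .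
qed

lemma (in comm_group) lincomb_insert:
  assumes "finite J" "i \<notin> J" "x ` insert i J \<subseteq> carrier G"
  shows "lincomb G x (insert i J) c = x i [^] c i \<otimes> lincomb G x J c"
  unfolding lincomb_def using assms by (intro finprod_insert) auto

lemma (in comm_group) lincomb_scale:
  assumes "x ` J \<subseteq> carrier G"
  shows "lincomb G x J (\<lambda>j. n * c j) = lincomb G x J c [^] (n::int)"
  using assms
proof (induction J rule: infinite_finite_induct)
  case (insert i J)
  have "x i [^] (n * c i) = (x i [^] c i) [^] n"
    using insert.prems by (simp add: int_pow_pow mult.commute)
  then show ?case
    using insert by (auto simp: lincomb_insert int_pow_distrib)
qed (auto simp: lincomb_def)

lemma (in comm_group) lincomb_diff:
  assumes "x ` J \<subseteq> carrier G"
  shows "lincomb G x J (\<lambda>j. c j - d j) = lincomb G x J c \<otimes> inv (lincomb G x J d)"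
proof -
  have "lincomb G x J (\<lambda>j. - d j) = inv (lincomb G x J d)"
    using lincomb_scale[OF assms, of "-1" d] assms by (simp add: int_pow_neg)
  then show ?thesis
    using lincomb_add[OF assms, of c "\<lambda>j. - d j"] by simp
qed

lemma (in comm_group) lincomb_mono_neutral:
  assumes "finite J" "A \<subseteq> J" "x ` J \<subseteq> carrier G" "\<And>j. j \<in> J - A \<Longrightarrow> c j = 0"
  shows "lincomb G x J c = lincomb G x A c"
  unfolding lincomb_def using assms by (intro finprod_mono_neutral_cong_right) auto

lemma (in comm_group) lincomb_single:
  assumes "finite J" "i \<in> J" "x ` J \<subseteq> carrier G"
  shows "lincomb G x J (\<lambda>j. if j = i then n else 0) = x i [^] n"
proof -
  have "lincomb G x J (\<lambda>j. if j = i then n else 0) = lincomb G x {i} (\<lambda>j. if j = i then n else 0)"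
    using assms by (intro lincomb_mono_neutral) auto
  also have "\<dots> = x i [^] n"
    using lincomb_insert[of "{}" i x] assms by (auto simp: lincomb_def)
  finally show ?thesis .
qed

lemma (in comm_group) lincomb_image:
  assumes "inj_on f J" "x ` f ` J \<subseteq> carrier G"
  shows "lincomb G x (f ` J) c = lincomb G (\<lambda>j. x (f j)) J (\<lambda>j. c (f j))"
  unfolding lincomb_def using assms by (intro finprod_reindex) auto

text \<open>The combinations form a subgroup containing every \<open>x i\<close>, which gives one
  inclusion; induction on the index set gives the other.\<close>

lemma (in comm_group) generate_eq_lincombs:
  assumes "finite J" "x ` J \<subseteq> carrier G"
  shows "generate G (x ` J) = range (lincomb G x J)"
proof
  have "subgroup (range (lincomb G x J)) G"
  proof
    show "range (lincomb G x J) \<subseteq> carrier G" using assms by auto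
    show "\<one> \<in> range (lincomb G x J)" using lincomb_zero[of J "\<lambda>_. 0" x] by (metis rangeI)
    show "a \<otimes> b \<in> range (lincomb G x J)"
      if "a \<in> range (lincomb G x J)" "b \<in> range (lincomb G x J)" for a b
      using that by (auto simp flip: lincomb_add[OF assms(2)])
    show "inv a \<in> range (lincomb G x J)" if "a \<in> range (lincomb G x J)" for a
    proof -
      obtain c where "a = lincomb G x J c" using \<open>a \<in> _\<close> by blast
      then have "inv a = lincomb G x J (\<lambda>j. 0 - c j)"
        using lincomb_diff[OF assms(2), of "\<lambda>_. 0" c] lincomb_zero[of J "\<lambda>_. 0" x] assms by simp
      then show ?thesis by blast
    qed
  qed
  moreover have "x ` J \<subseteq> range (lincomb G x J)"
  proof clarify
    fix i assume "i \<in> J"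
    then have "x i = lincomb G x J (\<lambda>j. if j = i then 1 else 0)"
      using assms lincomb_single[of J i x 1] by (auto simp: image_subset_iff)
    then show "x i \<in> range (lincomb G x J)" by blast
  qed
  ultimately show "generate G (x ` J) \<subseteq> range (lincomb G x J)"
    by (rule generate_subgroup_incl[rotated])
  \<comment> \<open>Stated for subsets \<open>I\<close> of \<open>J\<close> so that the generated
    subgroup stays fixed during the induction.\<close>
  have "lincomb G x I c \<in> generate G (x ` J)" if "I \<subseteq> J" for I c
    using finite_subset[OF that assms(1)] that
  proof (induction I rule: finite_induct)
    case empty
    show ?case by (auto simp: lincomb_def intro: generate.one)
  next
    case (insert i I)
    then have "x i [^] c i \<in> generate G (x ` J)"
      using assms by (intro subgroup_int_pow_closed generate_is_subgroup) (auto intro: generate.incl)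
    moreover have "x ` insert i I \<subseteq> carrier G" using insert.prems assms by blast
    ultimately show ?case
      using insert by (auto simp: lincomb_insert intro: generate.eng)
  qed
  then show "range (lincomb G x J) \<subseteq> generate G (x ` J)" by auto
qed

lemma lincomb_hom:
  assumes "comm_group G" "comm_group H" "h \<in> hom G H" "x ` J \<subseteq> carrier G"
  shows "h (lincomb G x J c) = lincomb H (\<lambda>j. h (x j)) J c"
proof -
  interpret G: comm_group G by fact
  interpret H: comm_group H by fact
  interpret h: group_hom G H h
    using assms by (simp add: group_hom_def group_hom_axioms_def G.is_group H.is_group)
  show ?thesis
    using assms(4)
  proof (induction J rule: infinite_finite_induct)
    case (insert i J)
    then have "(\<lambda>j. h (x j)) ` insert i J \<subseteq> carrier H" by auto
    with insert show ?case by (simp add: G.lincomb_insert H.lincomb_insert h.hom_int_pow)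
  qed (auto simp: lincomb_def)
qed

lemma (in comm_group) comm_group_subgroup:
  assumes "subgroup H G"
  shows "comm_group (G\<lparr>carrier := H\<rparr>)"
proof (rule group.group_comm_groupI)
  show "group (G\<lparr>carrier := H\<rparr>)" by (rule subgroup_imp_group[OF assms])
  show "x \<otimes>\<^bsub>G\<lparr>carrier := H\<rparr>\<^esub> y = y \<otimes>\<^bsub>G\<lparr>carrier := H\<rparr>\<^esub> x"
    if "x \<in> carrier (G\<lparr>carrier := H\<rparr>)" "y \<in> carrier (G\<lparr>carrier := H\<rparr>)" for x y
    using that subgroup.subset[OF assms] by (auto intro: m_comm)
qed

text \<open>The inclusion of \<open>H\<close> in \<open>G\<close> is a homomorphism, so
  \<open>lincomb_hom\<close> applies to it.\<close>

lemma (in comm_group) lincomb_subgroup: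
  assumes "subgroup H G" "x ` J \<subseteq> H"
  shows "lincomb (G\<lparr>carrier := H\<rparr>) x J c = lincomb G x J c"
proof -
  have "comm_group (G\<lparr>carrier := H\<rparr>)" by (rule comm_group_subgroup[OF assms(1)])
  then show ?thesis
    using lincomb_hom[of "G\<lparr>carrier := H\<rparr>" G "\<lambda>x. x" x J c] assms comm_group_axioms
      subgroup.subset[OF assms(1)]
    by (auto simp: hom_def)
qed

text \<open>If \<open>x i = x k\<close> with \<open>i\<close> and \<open>k\<close> distinct, the
  difference of the two unit vectors is a nontrivial relation.\<close>

lemma (in comm_group) independent_family_imp_Z_independent:
  assumes "independent_family G x J"
  shows "inj_on x J" "Z_independent G (x ` J)"
proof -
  have J: "finite J" "x ` J \<subseteq> carrier G" using assms by (auto simp: independent_family_def)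
  show inj: "inj_on x J"
  proof (rule inj_onI, rule ccontr)
    fix i k assume ik: "i \<in> J" "k \<in> J" "x i = x k" "i \<noteq> k"
    define d :: "'c \<Rightarrow> 'c \<Rightarrow> int" where "d = (\<lambda>i j. if j = i then 1 else 0)"
    have "lincomb G x J (\<lambda>j. d i j - d k j) = x i \<otimes> inv (x k)"
      using J ik by (auto simp: lincomb_diff d_def lincomb_single image_subset_iff)
    also have "\<dots> = \<one>" using ik J by (auto simp: image_subset_iff)
    finally have "d i i - d k i = 0" using assms ik by (auto simp: independent_family_def)
    then show False using ik by (simp add: d_def)
  qed
  show "Z_independent G (x ` J)"
    unfolding Z_independent_iff_family
    using assms J lincomb_image[OF inj, of "\<lambda>s. s"]
    by (auto simp: independent_family_def)
qed

lemma (in comm_group) independent_family_lincomb_inj: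
  assumes "independent_family G x J" "lincomb G x J c = lincomb G x J d" "j \<in> J"
  shows "c j = d j"
proof -
  have "x ` J \<subseteq> carrier G" using assms by (auto simp: independent_family_def)
  then have "lincomb G x J (\<lambda>j. c j - d j) = \<one>" using assms by (simp add: lincomb_diff)
  then show ?thesis using assms by (auto simp: independent_family_def)
qed

section \<open>Counting cosets\<close>

text \<open>Maps with the same fibres have images in bijection. This compares coset spaces without
  constructing isomorphisms of quotient groups.\<close>

lemma card_image_cong_fibres:
  assumes "\<And>x y. x \<in> A \<Longrightarrow> y \<in> A \<Longrightarrow> f x = f y \<longleftrightarrow> g x = g y"
  shows "card (f ` A) = card (g ` A)"
proof (rule bij_betw_same_card)
  define h where "h = (\<lambda>u. g (inv_into A f u))"
  have h: "h (f x) = g x" if "x \<in> A" for x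
    using that assms[of "inv_into A f (f x)" x] unfolding h_def
    by (simp add: inv_into_into f_inv_into_f)
  show "bij_betw h (f ` A) (g ` A)"
    unfolding bij_betw_def
  proof
    show "inj_on h (f ` A)" using h assms by (auto simp: inj_on_def)
    show "h ` f ` A = g ` A" using h by (force simp: image_image)
  qed
qed

lemma (in group) r_coset_eq_iff:
  assumes "subgroup H G" "x \<in> carrier G" "y \<in> carrier G"
  shows "H #> x = H #> y \<longleftrightarrow> x \<otimes> inv y \<in> H"
proof
  assume "H #> x = H #> y"
  then have "x \<in> H #> y" using rcos_self[OF assms(2,1)] by simp
  then show "x \<otimes> inv y \<in> H"
    using subgroup.rcos_module_imp[OF assms(1) is_group assms(3)] by blast
next
  assume "x \<otimes> inv y \<in> H"
  then have "x \<in> H #> y"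
    using subgroup.rcos_module_rev[OF assms(1) is_group assms(3,2)] by blast
  then show "H #> x = H #> y" using repr_independence assms by metis
qed

lemma (in group) r_coset_eq_self_iff:
  assumes "subgroup H G" "x \<in> carrier G"
  shows "H #> x = H \<longleftrightarrow> x \<in> H"
  using r_coset_eq_iff[OF assms(1,2) one_closed] assms
  by (simp add: coset_mult_one subgroup.subset)

text \<open>Lagrange for the kernel, whose cosets correspond to the fibres of \<open>h\<close> and
  hence to the points of the image.\<close>

lemma (in group_hom) card_kernel_times_image:
  assumes "finite (carrier G)"
  shows "card (kernel G H h) * card (h ` carrier G) = card (carrier G)"
proof -
  have "card (carrier (G Mod kernel G H h)) = card (h ` carrier G)"
    unfolding carrier_FactGroup
  proof (rule card_image_cong_fibres)
    fix x y assume xy: "x \<in> carrier G" "y \<in> carrier G"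
    have "kernel G H h #> x = kernel G H h #> y \<longleftrightarrow> h (x \<otimes> inv y) = \<one>\<^bsub>H\<^esub>"
      using xy by (subst G.r_coset_eq_iff[OF subgroup_kernel]) (auto simp: kernel_def)
    also have "\<dots> \<longleftrightarrow> h x = h y"
      using xy by (metis G.inv_closed H.inv_solve_right H.l_one H.one_closed hom_closed hom_inv hom_mult)
    finally show "kernel G H h #> x = kernel G H h #> y \<longleftrightarrow> h x = h y" .
  qed
  moreover have "carrier (G Mod kernel G H h) = rcosets\<^bsub>G\<^esub> kernel G H h"
    by (simp add: FactGroup_def)
  ultimately show ?thesis
    using G.lagrange[OF subgroup_kernel] by (simp add: order_def mult.commute)
qed

lemma group_card_kernel_times_image:
  assumes "group G" "group H" "h \<in> hom G H" "finite (carrier G)"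
  shows "card (kernel G H h) * card (h ` carrier G) = card (carrier G)"
  using assms by (intro group_hom.card_kernel_times_image) (auto simp: group_hom_def group_hom_axioms_def)

section \<open>Relations modulo a subgroup, counted over Z/N\<close>

text \<open>Reducing the coefficients modulo \<open>N\<close> changes the combination by an
  \<open>N\<close>-th multiple, which lies in \<open>H\<close>. Hence the choice of representatives
  of Z/N is immaterial.\<close>

lemma (in comm_group) lincomb_mod:
  assumes "subgroup H G" "x ` J \<subseteq> carrier G" "\<And>a. a \<in> carrier G \<Longrightarrow> a [^] N \<in> H"
  shows "H #> lincomb G x J (\<lambda>j. c j mod int N) = H #> lincomb G x J c"
proof -
  have "lincomb G x J c \<otimes> inv (lincomb G x J (\<lambda>j. c j mod int N))
      = lincomb G x J (\<lambda>j. c j - c j mod int N)"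
    using assms by (simp add: lincomb_diff)
  also have "\<dots> = lincomb G x J (\<lambda>j. int N * (c j div int N))"
    by (simp add: minus_mod_eq_mult_div)
  also have "\<dots> = lincomb G x J (\<lambda>j. c j div int N) [^] N"
    using assms by (simp add: lincomb_scale int_pow_int)
  also have "\<dots> \<in> H" using assms by simp
  finally show ?thesis using assms by (subst eq_commute) (simp add: r_coset_eq_iff)
qed

lemma (in comm_group) lincomb_hom_Mod:
  assumes "subgroup H G" "x ` J \<subseteq> carrier G" "\<And>a. a \<in> carrier G \<Longrightarrow> a [^] N \<in> H"
  shows "(\<lambda>c. H #> lincomb G x J c)
           \<in> hom (product_group J (\<lambda>_. integer_mod_group N)) (G Mod H)"
proof (rule homI)
  interpret H: normal H G using assms(1) by (simp add: normal_iff_subgroup)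
  fix c d
  show "H #> lincomb G x J c \<in> carrier (G Mod H)" using assms by (auto simp: carrier_FactGroup)
  have "lincomb G x J (c \<otimes>\<^bsub>product_group J (\<lambda>_. integer_mod_group N)\<^esub> d)
      = lincomb G x J (\<lambda>j. (c j + d j) mod int N)"
    using assms by (intro lincomb_cong) auto
  then show "H #> lincomb G x J (c \<otimes>\<^bsub>product_group J (\<lambda>_. integer_mod_group N)\<^esub> d)
      = (H #> lincomb G x J c) \<otimes>\<^bsub>G Mod H\<^esub> (H #> lincomb G x J d)"
    using assms by (simp add: lincomb_mod lincomb_add H.rcos_sum)
qed

lemma (in comm_group) lincomb_Mod_image:
  assumes "subgroup H G" "x ` J \<subseteq> carrier G" "finite J" "N > 0"
    and "\<And>a. a \<in> carrier G \<Longrightarrow> a [^] N \<in> H"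
  shows "(\<lambda>c. H #> lincomb G x J c) ` (\<Pi>\<^sub>E j\<in>J. {0..<int N}) = (\<lambda>a. H #> a) ` generate G (x ` J)"
proof -
  have "H #> lincomb G x J c \<in> (\<lambda>c. H #> lincomb G x J c) ` (\<Pi>\<^sub>E j\<in>J. {0..<int N})" for c
  proof
    have "lincomb G x J (\<lambda>j\<in>J. c j mod int N) = lincomb G x J (\<lambda>j. c j mod int N)"
      using assms by (intro lincomb_cong) auto
    then show "H #> lincomb G x J c = H #> lincomb G x J (\<lambda>j\<in>J. c j mod int N)"
      using lincomb_mod[OF assms(1,2,5), of c] by simp
    show "(\<lambda>j\<in>J. c j mod int N) \<in> (\<Pi>\<^sub>E j\<in>J. {0..<int N})" using assms by auto
  qed
  then show ?thesis using assms by (subst generate_eq_lincombs) auto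
qed

text \<open>Kernel times image for the homomorphism from (Z/N)^J to \<open>G Mod H\<close>. It
  serves twice: for a generating set in the duality argument, and with \<open>H\<close> equal to qG
  to count flows.\<close>

lemma (in comm_group) card_relations_times_image:
  assumes "subgroup H G" "x ` J \<subseteq> carrier G" "finite J" "N > 0"
    and "\<And>a. a \<in> carrier G \<Longrightarrow> a [^] N \<in> H"
  shows "card {c \<in> \<Pi>\<^sub>E j\<in>J. {0..<int N}. lincomb G x J c \<in> H} *
           card ((\<lambda>a. H #> a) ` generate G (x ` J)) = N ^ card J"
proof -
  let ?V = "product_group J (\<lambda>_. integer_mod_group N)" and ?h = "\<lambda>c. H #> lincomb G x J c"
  have V: "carrier ?V = (\<Pi>\<^sub>E j\<in>J. {0..<int N})" using assms by (simp add: carrier_integer_mod_group)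
  have "group (G Mod H)"
    using abelian_FactGroup[OF assms(1)] by (simp add: comm_group_def)
  then have "card (kernel ?V (G Mod H) ?h) * card (?h ` carrier ?V) = card (carrier ?V)"
    using assms lincomb_hom_Mod[OF assms(1,2,5)] unfolding V
    by (intro group_card_kernel_times_image[of ?V "G Mod H" ?h, unfolded V])
       (auto intro!: finite_PiE)
  moreover have "kernel ?V (G Mod H) ?h = {c \<in> \<Pi>\<^sub>E j\<in>J. {0..<int N}. lincomb G x J c \<in> H}"
    unfolding kernel_def V using assms by (simp add: r_coset_eq_self_iff)
  ultimately show ?thesis
    using assms(3) lincomb_Mod_image[OF assms(1-5)] unfolding V by (simp add: card_PiE)
qed

text \<open>The quotient is an image of the finite group (Z/N)^T.\<close>

lemma (in comm_group) finite_Mod: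
  assumes "subgroup H G" "finite T" "T \<subseteq> carrier G" "generate G T = carrier G" "N > 0"
    and "\<And>a. a \<in> carrier G \<Longrightarrow> a [^] (N::nat) \<in> H"
  shows "finite (carrier (G Mod H))"
proof -
  have "finite ((\<lambda>c. H #> lincomb G (\<lambda>t. t) T c) ` (\<Pi>\<^sub>E j\<in>T. {0..<int N}))"
    using assms by (intro finite_imageI finite_PiE) auto
  then show ?thesis
    using assms lincomb_Mod_image[of H "\<lambda>t. t" T N] by (simp add: carrier_FactGroup)
qed

section \<open>Duality\<close>

text \<open>The additive character exp(2 pi i a / q) of Z/q, written on integers.\<close>

definition root_char :: "nat \<Rightarrow> int \<Rightarrow> complex" where
  "root_char q a = cis (2 * pi * of_int a / of_nat q)"

lemma root_char_add: "root_char q (a + b) = root_char q a * root_char q b"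
  by (simp add: root_char_def cis_mult add_divide_distrib distrib_left)

lemma root_char_eq_1_iff:
  assumes "q > 0"
  shows "root_char q a = 1 \<longleftrightarrow> int q dvd a"
proof
  assume "root_char q a = 1"
  then have "cos (2 * pi * of_int a / of_nat q) = 1"
    by (metis Re_complex_of_real cis.sel(1) of_real_1 root_char_def)
  then obtain n :: int where "2 * pi * of_int a / of_nat q = of_int n * 2 * pi"
    by (auto simp: cos_one_2pi_int)
  then have "(of_int a :: real) = of_int (n * int q)"
    using assms by (simp add: field_simps)
  then show "int q dvd a" by (metis dvd_triv_right of_int_eq_iff)
next
  assume "int q dvd a"
  then obtain n where "a = int q * n" by (elim dvdE)
  then have "2 * pi * of_int a / of_nat q = 2 * pi * of_int n"
    using assms by simp
  then show "root_char q a = 1" by (simp add: root_char_def)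
qed

lemma root_char_mod:
  assumes "q > 0"
  shows "root_char q (r * (a mod int q)) = root_char q (r * a)"
proof -
  have "r * a = r * (a mod int q) + int q * (r * (a div int q))"
    by (metis add.commute distrib_left mult.left_commute mult_div_mod_eq)
  then have "root_char q (r * a) = root_char q (r * (a mod int q)) * 1"
    using root_char_add root_char_eq_1_iff[OF assms, of "int q * (r * (a div int q))"] by simp
  then show ?thesis by simp
qed

lemma root_char_sum: "root_char q (\<Sum>j\<in>J. f j) = (\<Prod>j\<in>J. root_char q (f j))"
  by (induction J rule: infinite_finite_induct) (auto simp: root_char_add, auto simp: root_char_def)

text \<open>Translation by some \<open>y\<close> with \<open>\<chi> y \<noteq> 1\<close> permutes
  the group and multiplies the sum by \<open>\<chi> y\<close>, so the sum vanishes.\<close>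

lemma (in group) sum_character:
  fixes \<chi> :: "'a \<Rightarrow> complex"
  assumes "finite (carrier G)"
    and "\<And>x y. x \<in> carrier G \<Longrightarrow> y \<in> carrier G \<Longrightarrow> \<chi> (x \<otimes> y) = \<chi> x * \<chi> y"
  shows "(\<Sum>x\<in>carrier G. \<chi> x) = (if \<forall>x\<in>carrier G. \<chi> x = 1 then of_nat (card (carrier G)) else 0)"
proof (cases "\<forall>x\<in>carrier G. \<chi> x = 1")
  case False
  then obtain y where y: "y \<in> carrier G" "\<chi> y \<noteq> 1" by blast
  have "(\<Sum>x\<in>carrier G. \<chi> x) = (\<Sum>x\<in>carrier G. \<chi> (y \<otimes> x))"
    by (rule sum.reindex_bij_witness[of _ "\<lambda>x. y \<otimes> x" "\<lambda>x. inv y \<otimes> x"])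
       (use y in \<open>auto simp flip: m_assoc\<close>)
  also have "\<dots> = \<chi> y * (\<Sum>x\<in>carrier G. \<chi> x)"
    using y assms by (simp add: sum_distrib_left)
  finally have "(\<Sum>x\<in>carrier G. \<chi> x) = 0" using y by simp
  then show ?thesis using False by (simp only: if_False)
qed simp

text \<open>Both sides count \<open>\<Sum>\<^sub>r \<Sum>\<^sub>y \<omega>\<^bsup>r \<sqdot> y\<^esup>\<close> over \<open>r \<in> R\<close> and \<open>y \<in> (\<int>/q)\<^sup>J\<close>.\<close>

lemma card_orthogonal_complement:
  fixes q :: nat and J :: "'j set"
  defines "V \<equiv> product_group J (\<lambda>_. integer_mod_group q)"
  assumes "finite J" "q > 0" "subgroup R V"
  shows "card R * card {y \<in> carrier V. \<forall>r\<in>R. int q dvd (\<Sum>j\<in>J. r j * y j)} = q ^ card J"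
proof -
  define \<chi> where "\<chi> r y = root_char q (\<Sum>j\<in>J. r j * y j)" for r y :: "'j \<Rightarrow> int"
  have V: "carrier V = (\<Pi>\<^sub>E j\<in>J. {0..<int q})"
    using assms by (simp add: V_def carrier_integer_mod_group)
  interpret V: group V unfolding V_def by simp
  have fin: "finite (carrier V)" unfolding V using assms by (intro finite_PiE) auto
  have R: "R \<subseteq> carrier V" using assms(4) by (rule subgroup.subset)
  interpret R: group "V\<lparr>carrier := R\<rparr>" by (rule V.subgroup_imp_group[OF assms(4)])
  have comm: "\<chi> r y = \<chi> y r" for r y by (simp add: \<chi>_def mult.commute)
  have hom: "\<chi> r (y \<otimes>\<^bsub>V\<^esub> z) = \<chi> r y * \<chi> r z" for r y z
    unfolding \<chi>_def root_char_sum V_def using assms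
    by (simp add: root_char_mod distrib_left root_char_add flip: prod.distrib)
  have nondeg: "(\<forall>y\<in>carrier V. \<chi> r y = 1) \<longleftrightarrow> r = \<one>\<^bsub>V\<^esub>" if r: "r \<in> carrier V" for r
  proof
    assume *: "\<forall>y\<in>carrier V. \<chi> r y = 1"
    have "r j = 0" if j: "j \<in> J" for j
    proof -
      \<comment> \<open>The unit vector at \<open>j\<close>. Its entry is \<open>1 mod int q\<close>
        because for \<open>q = 1\<close> the only representative is 0.\<close>
      define y where "y = (\<lambda>k\<in>J. if k = j then 1 mod int q else 0)"
      have "y \<in> carrier V" unfolding V y_def using assms by auto
      then have "int q dvd (\<Sum>k\<in>J. r k * y k)"
        using * assms by (simp add: \<chi>_def root_char_eq_1_iff)
      also have "(\<Sum>k\<in>J. r k * y k) = (\<Sum>k\<in>J. if k = j then r k * (1 mod int q) else 0)"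
        by (intro sum.cong) (auto simp: y_def)
      also have "\<dots> = r j * (1 mod int q)" using j assms by simp
      finally have "r j * (1 mod int q) mod int q = 0" by simp
      then have "r j mod int q = 0" by (simp add: mod_mult_right_eq)
      moreover have "r j \<in> {0..<int q}" using r j unfolding V by (rule PiE_mem)
      ultimately show "r j = 0" by simp
    qed
    with r show "r = \<one>\<^bsub>V\<^esub>" unfolding V by (auto simp: V_def PiE_iff extensional_def fun_eq_iff)
  next
    assume "r = \<one>\<^bsub>V\<^esub>"
    then have "(\<Sum>j\<in>J. r j * y j) = 0" for y by (auto simp: V_def intro!: sum.neutral)
    then show "\<forall>y\<in>carrier V. \<chi> r y = 1" using assms by (simp add: \<chi>_def root_char_eq_1_iff)
  qed
  \<comment> \<open>Summing over \<open>y\<close> first: by nondegeneracy of the pairing only the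
    zero vector \<open>r\<close> contributes.\<close>
  have "(\<Sum>r\<in>R. \<Sum>y\<in>carrier V. \<chi> r y)
      = (\<Sum>r\<in>R. if r = \<one>\<^bsub>V\<^esub> then of_nat (card (carrier V)) else 0)"
    using R nondeg fin hom by (intro sum.cong) (auto simp: V.sum_character subset_iff)
  also have "\<dots> = of_nat (card (carrier V))"
    using finite_subset[OF R fin] subgroup.one_closed[OF assms(4)] by simp
  finally have 1: "(\<Sum>r\<in>R. \<Sum>y\<in>carrier V. \<chi> r y) = of_nat (card (carrier V))" .
  \<comment> \<open>Summing over \<open>r\<close> first: a vector \<open>y\<close> contributes
    \<open>card R\<close> exactly when it is orthogonal to \<open>R\<close>.\<close>
  have "(\<Sum>r\<in>R. \<chi> r y) = (if \<forall>r\<in>R. \<chi> r y = 1 then of_nat (card R) else 0)" for y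
    using R.sum_character[of "\<lambda>r. \<chi> r y"] finite_subset[OF R fin] hom by (simp add: comm[of _ y])
  then have "(\<Sum>y\<in>carrier V. \<Sum>r\<in>R. \<chi> r y)
      = (\<Sum>y\<in>carrier V. if \<forall>r\<in>R. int q dvd (\<Sum>j\<in>J. r j * y j) then of_nat (card R) else 0)"
    using assms by (simp add: \<chi>_def root_char_eq_1_iff)
  also have "\<dots> = of_nat (card R * card {y \<in> carrier V. \<forall>r\<in>R. int q dvd (\<Sum>j\<in>J. r j * y j)})"
    using fin by (simp flip: sum.inter_filter)
  finally have "of_nat (card R * card {y \<in> carrier V. \<forall>r\<in>R. int q dvd (\<Sum>j\<in>J. r j * y j)})
      = (of_nat (card (carrier V)) :: complex)"
    using 1 sum.swap[of "\<chi>" "carrier V" R] by simp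
  then show ?thesis
    unfolding of_nat_eq_iff using assms by (simp add: V_def card_PiE carrier_integer_mod_group)
qed

lemma lincomb_integer_mod_group:
  assumes "y ` J \<subseteq> carrier (integer_mod_group q)"
  shows "lincomb (integer_mod_group q) y J c = (\<Sum>j\<in>J. c j * y j) mod int q"
  using assms
proof (induction J rule: infinite_finite_induct)
  case (insert i J)
  interpret Z: comm_group "integer_mod_group q" by simp
  show ?case
    using insert by (simp add: Z.lincomb_insert int_pow_integer_mod_group mod_add_eq)
qed (simp_all add: comm_group.lincomb_zero[OF abelian_integer_mod_group] lincomb_def finprod_def)

text \<open>Take a finite generating set \<open>T\<close>, and let \<open>R\<close> consist of the
  coefficient vectors modulo \<open>q\<close> whose combination lies in \<open>H\<close>. A
  homomorphism killing \<open>H\<close> is determined by its values on \<open>T\<close>, and a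
  vector of values occurs exactly when it is orthogonal to \<open>R\<close>. Both [G : H] and the
  number of such vectors are q^|T| / |R|.\<close>

lemma (in comm_group) card_Hom_annihilating:
  assumes "finitely_generated G" "subgroup H G" "q > 0" "\<And>a. a \<in> carrier G \<Longrightarrow> a [^] q \<in> H"
  shows "card {\<phi> \<in> Hom_set G (integer_mod_group q). \<forall>h\<in>H. \<phi> h = 0} = card (carrier (G Mod H))"
proof -
  obtain T where T: "finite T" "T \<subseteq> carrier G" "generate G T = carrier G"
    using assms by (auto simp: finitely_generated_def)
  define V where "V = product_group T (\<lambda>_. integer_mod_group q)"
  define L where "L = lincomb G (\<lambda>t. t) T"
  define R where "R = {c \<in> carrier V. L c \<in> H}"
  define P where "P = {y \<in> carrier V. \<forall>r\<in>R. int q dvd (\<Sum>j\<in>T. r j * y j)}"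
  define \<H> where "\<H> = {\<phi> \<in> Hom_set G (integer_mod_group q). \<forall>h\<in>H. \<phi> h = 0}"
  have V: "carrier V = (\<Pi>\<^sub>E j\<in>T. {0..<int q})"
    using assms by (simp add: V_def carrier_integer_mod_group)
  have L: "range L = carrier G"
    using generate_eq_lincombs[of T "\<lambda>t. t"] T by (simp add: L_def)
  have Lt: "L (\<lambda>j. if j = t then 1 else 0) = t" if "t \<in> T" for t
    using lincomb_single[of T t "\<lambda>t. t" 1] T that by (auto simp: L_def)
  have sgR: "subgroup R V"
  proof -
    have "group_hom V (G Mod H) (\<lambda>c. H #> L c)"
      using assms T lincomb_hom_Mod[of H "\<lambda>t. t" T q] abelian_FactGroup[OF assms(2)]
      by (auto simp: group_hom_def group_hom_axioms_def V_def L_def comm_group_def)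
    then have "subgroup (kernel V (G Mod H) (\<lambda>c. H #> L c)) V" by (rule group_hom.subgroup_kernel)
    moreover have "kernel V (G Mod H) (\<lambda>c. H #> L c) = R"
      unfolding kernel_def R_def using assms L r_coset_eq_self_iff[OF assms(2)] by auto
    ultimately show ?thesis by simp
  qed
  have "R = {c \<in> \<Pi>\<^sub>E j\<in>T. {0..<int q}. lincomb G (\<lambda>t. t) T c \<in> H}"
    unfolding R_def V L_def ..
  then have "card R * card (carrier (G Mod H)) = q ^ card T"
    using card_relations_times_image[of H "\<lambda>t. t" T q] T assms by (simp add: carrier_FactGroup)
  moreover have "card R * card P = q ^ card T"
    unfolding P_def V_def
    using card_orthogonal_complement[of T q R] T assms sgR by (simp add: V_def)
  \<comment> \<open>\<open>card R\<close> cancels since both products equal the nonzero number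
    \<open>q ^ card T\<close>.\<close>
  ultimately have "card (carrier (G Mod H)) = card P"
    using assms by (metis mult_cancel1 mult_is_0 power_not_zero less_numeral_extra(3))
  also have "bij_betw (\<lambda>\<phi>. restrict \<phi> T) \<H> P"
  proof -
    have hom_L: "\<phi> (L c) = (\<Sum>t\<in>T. c t * \<phi> t) mod int q" if "\<phi> \<in> \<H>" for \<phi> c
    proof -
      have "\<phi> \<in> hom G (integer_mod_group q)" using that by (simp add: \<H>_def Hom_set_def)
      moreover from this have "\<phi> ` T \<subseteq> carrier (integer_mod_group q)" using T by (auto simp: hom_def)
      ultimately show ?thesis
        using lincomb_hom[of G "integer_mod_group q" \<phi> "\<lambda>t. t" T c] T
        by (simp add: L_def lincomb_integer_mod_group comm_group_axioms)
    qed
    show ?thesis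
      unfolding bij_betw_def
    proof
      show "inj_on (\<lambda>\<phi>. restrict \<phi> T) \<H>"
      proof (rule inj_onI)
        fix \<phi> \<psi> assume *: "\<phi> \<in> \<H>" "\<psi> \<in> \<H>" "restrict \<phi> T = restrict \<psi> T"
        then have "\<phi> t = \<psi> t" if "t \<in> T" for t using that by (metis restrict_apply')
        then have "\<phi> (L c) = \<psi> (L c)" for c using * by (simp add: hom_L)
        then have "\<phi> x = \<psi> x" if "x \<in> carrier G" for x using that L by (metis imageE)
        then show "\<phi> = \<psi>"
          using * by (auto simp: \<H>_def Hom_set_def intro: extensionalityI)
      qed
      show "(\<lambda>\<phi>. restrict \<phi> T) ` \<H> = P"
      proof (intro equalityI subsetI)
        fix y assume "y \<in> (\<lambda>\<phi>. restrict \<phi> T) ` \<H>"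
        then obtain \<phi> where \<phi>: "\<phi> \<in> \<H>" "y = restrict \<phi> T" by blast
        have "\<phi> t \<in> {0..<int q}" if "t \<in> T" for t
          using \<phi> that T assms by (auto simp: \<H>_def Hom_set_def hom_def carrier_integer_mod_group)
        moreover have "int q dvd (\<Sum>j\<in>T. r j * y j)" if "r \<in> R" for r
          using hom_L[OF \<phi>(1), of r] \<phi> that by (simp add: \<H>_def R_def dvd_eq_mod_eq_0)
        ultimately show "y \<in> P" using \<phi> by (auto simp: P_def V)
      next
        fix y assume y: "y \<in> P"
        have y': "y t \<in> {0..<int q}" if "t \<in> T" for t using y that by (auto simp: P_def V)
        \<comment> \<open>Membership in \<open>P\<close> gives orthogonality only to reduced
          vectors; reducing \<open>c\<close> modulo \<open>q\<close> changes neither the coset of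
          \<open>L c\<close> nor the sum modulo \<open>q\<close>.\<close>
        have annih: "int q dvd (\<Sum>t\<in>T. c t * y t)" if "L c \<in> H" for c
        proof -
          define d where "d = (\<lambda>t\<in>T. c t mod int q)"
          have Ld: "H #> L d = H #> L c"
            using lincomb_mod[of H "\<lambda>t. t" T q c] lincomb_cong[of T "\<lambda>t. t" "\<lambda>t. t" d "\<lambda>t. c t mod int q"]
              assms T by (simp add: L_def d_def)
          have "L d \<in> H"
            using that Ld assms L r_coset_eq_self_iff by (metis rangeI)
          then have "d \<in> R" using assms by (auto simp: R_def V d_def)
          then have "(\<Sum>t\<in>T. d t * y t) mod int q = 0" using y by (auto simp: P_def)
          also have "(\<Sum>t\<in>T. d t * y t) mod int q = (\<Sum>t\<in>T. c t * y t) mod int q"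
            by (subst (1 2) mod_sum_eq[symmetric]) (simp add: d_def mod_mult_left_eq)
          finally show ?thesis by (simp only: dvd_eq_mod_eq_0)
        qed
        \<comment> \<open>The homomorphism with values \<open>y\<close> on \<open>T\<close>,
          computed from an arbitrary representation of \<open>x\<close>. Two representations differ
          by a relation, whose combination \<open>\<one>\<close> lies in \<open>H\<close>, so
          \<open>annih\<close> makes the value independent of the choice.\<close>
        define \<phi> where "\<phi> = (\<lambda>x\<in>carrier G. (\<Sum>t\<in>T. (SOME c. L c = x) t * y t) mod int q)"
        have \<phi>: "\<phi> (L c) = (\<Sum>t\<in>T. c t * y t) mod int q" for c
        proof -
          define d where "d = (SOME d. L d = L c)"
          have "L d = L c" unfolding d_def by (rule someI[of "\<lambda>d. L d = L c"]) (rule refl)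
          then have "L (\<lambda>t. d t - c t) = \<one>"
            using T L by (auto simp: L_def lincomb_diff)
          then have "int q dvd (\<Sum>t\<in>T. (d t - c t) * y t)"
            using assms by (intro annih) (simp add: subgroup.one_closed)
          then have "int q dvd (\<Sum>t\<in>T. d t * y t) - (\<Sum>t\<in>T. c t * y t)"
            by (simp add: left_diff_distrib sum_subtractf)
          then show ?thesis
            using L by (auto simp: \<phi>_def d_def mod_eq_dvd_iff)
        qed
        have "\<phi> \<in> hom G (integer_mod_group q)"
        proof (rule homI)
          fix a b assume "a \<in> carrier G" "b \<in> carrier G"
          then obtain c d where [simp]: "a = L c" "b = L d" using L by (metis imageE)
          show "\<phi> a \<in> carrier (integer_mod_group q)"
            using assms by (simp add: \<phi> carrier_integer_mod_group)
          have "a \<otimes> b = L (\<lambda>t. c t + d t)" using T by (simp add: L_def lincomb_add)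
          then show "\<phi> (a \<otimes> b) = \<phi> a \<otimes>\<^bsub>integer_mod_group q\<^esub> \<phi> b"
            by (simp only: \<phi>) (simp add: \<phi> mod_add_eq distrib_right sum.distrib)
        qed
        moreover have "\<phi> h = 0" if "h \<in> H" for h
        proof -
          have "h \<in> carrier G" using that assms by (simp add: subgroup.mem_carrier)
          then obtain c where "h = L c" using L by (metis imageE)
          then show ?thesis using annih[of c] that by (simp add: \<phi>)
        qed
        ultimately have "\<phi> \<in> \<H>" by (auto simp: \<H>_def Hom_set_def \<phi>_def)
        moreover have "restrict \<phi> T = y"
        proof
          fix t
          have "\<phi> t = y t" if "t \<in> T"
          proof -
            have "\<phi> t = (\<Sum>j\<in>T. (if j = t then 1 else 0) * y j) mod int q"
              using \<phi>[of "\<lambda>j. if j = t then 1 else 0"] that by (simp add: Lt)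
            also have "(\<Sum>j\<in>T. (if j = t then 1 else 0) * y j) = (\<Sum>j\<in>T. if j = t then y j else 0)"
              by (intro sum.cong) auto
            finally show ?thesis using that T y'[OF that] by simp
          qed
          then show "restrict \<phi> T t = y t"
            using y by (auto simp: P_def V PiE_iff extensional_def)
        qed
        ultimately show "y \<in> (\<lambda>\<phi>. restrict \<phi> T) ` \<H>" by blast
      qed
    qed
  qed
  then have "card P = card \<H>" by (simp add: bij_betw_same_card)
  finally show ?thesis unfolding \<H>_def by simp
qed

section \<open>Rank\<close>

text \<open>The preimage in \<open>G\<close> of the torsion of \<open>G Mod F\<close> when
  \<open>F\<close> is a subgroup. That it exhausts the carrier expresses that \<open>F\<close> has
  full rank.\<close>

definition isolator :: "('g, 'b) monoid_scheme \<Rightarrow> 'g set \<Rightarrow> 'g set" where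
  "isolator G F = {x \<in> carrier G. \<exists>n::nat. n > 0 \<and> x [^]\<^bsub>G\<^esub> n \<in> F}"

lemma torsion_eq_isolator: "torsion G = isolator G {\<one>\<^bsub>G\<^esub>}"
  by (auto simp: torsion_def isolator_def)

lemma (in group) subgroup_nat_pow_closed:
  assumes "subgroup H G" "h \<in> H"
  shows "h [^] (n::nat) \<in> H"
  using subgroup_int_pow_closed[OF assms, of "int n"] by (simp add: int_pow_int)

lemma (in comm_group) subgroup_isolator:
  assumes F: "subgroup F G"
  shows "subgroup (isolator G F) G"
proof
  show "isolator G F \<subseteq> carrier G" by (auto simp: isolator_def)
  show "\<one> \<in> isolator G F"
    using subgroup.one_closed[OF F] by (auto simp: isolator_def intro!: exI[of _ 1])
  show "inv a \<in> isolator G F" if "a \<in> isolator G F" for a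
    using that subgroup.m_inv_closed[OF F] by (force simp: isolator_def nat_pow_inv)
  fix a b assume ab: "a \<in> isolator G F" "b \<in> isolator G F"
  then obtain m n :: nat where mn: "m > 0" "n > 0" "a [^] m \<in> F" "b [^] n \<in> F"
    and [simp]: "a \<in> carrier G" "b \<in> carrier G" by (auto simp: isolator_def)
  have "(a \<otimes> b) [^] (m * n) = (a [^] m) [^] n \<otimes> (b [^] n) [^] m"
    by (simp add: nat_pow_distrib nat_pow_pow mult.commute)
  also have "\<dots> \<in> F" using mn F by (simp add: subgroup.m_closed subgroup_nat_pow_closed)
  finally show "a \<otimes> b \<in> isolator G F" using mn by (auto simp: isolator_def intro!: exI[of _ "m * n"])
qed

lemma (in comm_group) generate_subset_isolator:
  assumes "subgroup F G" "T \<subseteq> isolator G F"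
  shows "generate G T \<subseteq> isolator G F"
  using generate_subgroup_incl[OF assms(2) subgroup_isolator[OF assms(1)]] .

lemma (in comm_group) power_hom: "(\<lambda>x. x [^] (q::nat)) \<in> hom G G"
  by (rule homI) (auto simp: nat_pow_distrib)

lemma (in comm_group) power_group_hom: "group_hom G G (\<lambda>x. x [^] (q::nat))"
  using power_hom by (simp add: group_hom_def group_hom_axioms_def is_group)

lemma (in comm_group) subgroup_multiples:
  assumes "subgroup H G"
  shows "subgroup (multiples G q H) G"
  unfolding multiples_def by (rule group_hom.subgroup_img_is_subgroup[OF power_group_hom assms])

text \<open>The product of exponents that work for the finitely many generators works for every
  element.\<close>

lemma (in comm_group) common_exponent:
  assumes "finite T" "T \<subseteq> isolator G F" "generate G T = carrier G" and F: "subgroup F G"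
  shows "\<exists>N>0. \<forall>a\<in>carrier G. a [^] (N::nat) \<in> F"
proof -
  have "\<exists>n. \<forall>t\<in>T. n t > 0 \<and> t [^] (n t :: nat) \<in> F"
    using assms(2) by (intro bchoice) (auto simp: isolator_def)
  then obtain n where n: "\<And>t. t \<in> T \<Longrightarrow> n t > 0" "\<And>t. t \<in> T \<Longrightarrow> t [^] (n t :: nat) \<in> F" by blast
  define N where "N = (\<Prod>t\<in>T. n t)"
  have T: "T \<subseteq> carrier G" using assms(2) by (auto simp: isolator_def)
  have "subgroup {a \<in> carrier G. a [^] N \<in> F} G"
    using F by unfold_locales
      (auto simp: nat_pow_distrib nat_pow_inv subgroup.m_closed subgroup.one_closed subgroup.m_inv_closed)
  moreover have "T \<subseteq> {a \<in> carrier G. a [^] N \<in> F}"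
  proof
    fix t assume t: "t \<in> T"
    then have "n t dvd N" unfolding N_def using assms(1) by (intro dvd_prodI)
    then obtain k where "N = n t * k" by (elim dvdE)
    then have "t [^] N = (t [^] n t) [^] k" using t T by (simp add: nat_pow_pow subset_iff)
    then show "t \<in> {a \<in> carrier G. a [^] N \<in> F}"
      using t T n(2) subgroup_nat_pow_closed[OF F] by auto
  qed
  ultimately have "generate G T \<subseteq> {a \<in> carrier G. a [^] N \<in> F}"
    by (intro generate_subgroup_incl)
  moreover have "N > 0" unfolding N_def using n(1) by (simp add: prod_pos)
  ultimately show ?thesis using assms(3) by auto
qed

lemma (in comm_group) finite_Mod_isolated:
  assumes "finitely_generated G" "subgroup F G" "carrier G \<subseteq> isolator G F"
  shows "finite (carrier (G Mod F))"
proof -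
  obtain T where T: "finite T" "T \<subseteq> carrier G" "generate G T = carrier G"
    using assms by (auto simp: finitely_generated_def)
  then obtain N :: nat where "N > 0" "\<forall>a\<in>carrier G. a [^] N \<in> F"
    using common_exponent[of T F] assms by blast
  then show ?thesis using finite_Mod[of F T N] T assms by blast
qed

text \<open>The third isomorphism theorem at the level of cardinalities; \<open>M\<close> is the
  preimage of \<open>D\<close> under the projection to \<open>G Mod H\<close>.\<close>

lemma (in comm_group) card_iterated_Mod:
  assumes H: "subgroup H G" and D: "subgroup D (G Mod H)"
    and M: "subgroup M G" "\<And>x. x \<in> carrier G \<Longrightarrow> H #> x \<in> D \<longleftrightarrow> x \<in> M"
  shows "card (carrier ((G Mod H) Mod D)) = card (carrier (G Mod M))"
proof -
  interpret Q: comm_group "G Mod H" by (rule abelian_FactGroup[OF H])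
  interpret q: group_hom G "G Mod H" "\<lambda>x. H #> x"
    using H normal.r_coset_hom_Mod[of H G]
    by (simp add: group_hom_def group_hom_axioms_def is_group Q.is_group normal_iff_subgroup)
  have "carrier ((G Mod H) Mod D) = (\<lambda>x. D #>\<^bsub>G Mod H\<^esub> (H #> x)) ` carrier G"
    unfolding carrier_FactGroup by (simp add: image_image)
  moreover have *: "(D #>\<^bsub>G Mod H\<^esub> (H #> x) = D #>\<^bsub>G Mod H\<^esub> (H #> y)) \<longleftrightarrow> (M #> x = M #> y)"
    if "x \<in> carrier G" "y \<in> carrier G" for x y
  proof -
    have "(D #>\<^bsub>G Mod H\<^esub> (H #> x) = D #>\<^bsub>G Mod H\<^esub> (H #> y))
        \<longleftrightarrow> (H #> x) \<otimes>\<^bsub>G Mod H\<^esub> inv\<^bsub>G Mod H\<^esub> (H #> y) \<in> D"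
      using that q.hom_closed by (intro Q.r_coset_eq_iff D) auto
    also have "(H #> x) \<otimes>\<^bsub>G Mod H\<^esub> inv\<^bsub>G Mod H\<^esub> (H #> y) = H #> (x \<otimes> inv y)"
      using that by (metis inv_closed q.hom_inv q.hom_mult)
    also have "(H #> (x \<otimes> inv y) \<in> D) \<longleftrightarrow> x \<otimes> inv y \<in> M"
      using that by (intro M(2)) simp
    also have "\<dots> \<longleftrightarrow> M #> x = M #> y" using that M(1) by (simp add: r_coset_eq_iff)
    finally show ?thesis .
  qed
  moreover from * have "card ((\<lambda>x. D #>\<^bsub>G Mod H\<^esub> (H #> x)) ` carrier G) = card ((\<lambda>x. M #> x) ` carrier G)"
    by (rule card_image_cong_fibres)
  ultimately show ?thesis by (simp only: carrier_FactGroup[of G M])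
qed

text \<open>
  With \<open>F = \<langle>x\<^sub>j\<rangle>\<close> and \<open>Q = G / qF\<close>, a finite group, multiplication by \<open>q\<close> gives \<open>|Q / qQ| = |Q[q]|\<close>. Here
  \<open>Q / qQ = G / qG\<close>, and \<open>Q[q] = F / qF \<oplus> G[q]\<close> because \<open>F\<close> is free.
\<close>

lemma (in comm_group) card_Mod_multiples:
  assumes fg: "finitely_generated G" and ind: "independent_family G x J"
    and iso: "carrier G \<subseteq> isolator G (generate G (x ` J))" and "q > 0"
  shows "card (carrier (G Mod multiples G q (carrier G)))
       = q ^ card J * card {a \<in> carrier G. a [^] q = \<one>}"
proof -
  define F where "F = generate G (x ` J)"
  define qF where "qF = multiples G q F"
  define Q where "Q = G Mod qF"
  define D where "D = (\<lambda>Y. Y [^]\<^bsub>Q\<^esub> q) ` carrier Q"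
  have J: "finite J" "x ` J \<subseteq> carrier G" using ind by (auto simp: independent_family_def)
  have F: "subgroup F G" unfolding F_def using J by (intro generate_is_subgroup) auto
  have qF: "subgroup qF G" unfolding qF_def by (rule subgroup_multiples[OF F])
  have F_eq: "F = range (lincomb G x J)" unfolding F_def using J by (rule generate_eq_lincombs)
  have qF_eq: "qF = range (\<lambda>c. lincomb G x J (\<lambda>j. int q * c j))"
    unfolding qF_def multiples_def F_eq using J by (auto simp: lincomb_scale int_pow_int image_image)
  have pow_lc: "lincomb G x J c [^] q = lincomb G x J (\<lambda>j. int q * c j)" for c
    using J by (simp add: lincomb_scale int_pow_int)
  have normal: "qF \<lhd> G" using qF by (simp add: normal_iff_subgroup)
  have pow_Q: "(qF #> a) [^]\<^bsub>Q\<^esub> n = qF #> (a [^] n)" if "a \<in> carrier G" for a and n :: nat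
    unfolding Q_def using normal.FactGroup_pow[OF normal that] .
  interpret Q: comm_group Q unfolding Q_def by (rule abelian_FactGroup[OF qF])
  have one_Q: "\<one>\<^bsub>Q\<^esub> = qF" by (simp add: Q_def)
  have D: "subgroup D Q"
    unfolding D_def using Q.subgroup_multiples[OF Q.subgroup_self] by (simp add: multiples_def)
  have "carrier G \<subseteq> isolator G qF"
  proof
    fix a assume a: "a \<in> carrier G"
    then obtain n :: nat where n: "n > 0" "a [^] n \<in> F" using iso by (auto simp: isolator_def F_def)
    then have "a [^] (n * q) \<in> qF" using a by (auto simp: qF_def multiples_def simp flip: nat_pow_pow)
    then show "a \<in> isolator G qF"
      using a n \<open>q > 0\<close> by (auto simp: isolator_def intro!: exI[of _ "n * q"])
  qed
  then have fin: "finite (carrier Q)" unfolding Q_def by (rule finite_Mod_isolated[OF fg qF])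
  \<comment> \<open>The preimage of qQ in \<open>G\<close> is qG, because qF is contained in
    qG.\<close>
  have "card (carrier (Q Mod D)) = card (carrier (G Mod multiples G q (carrier G)))"
    unfolding Q_def
  proof (rule card_iterated_Mod[OF qF D[unfolded Q_def] subgroup_multiples[OF subgroup_self]])
    fix a assume a: "a \<in> carrier G"
    have "qF #> a \<in> D \<longleftrightarrow> (\<exists>b\<in>carrier G. qF #> a = qF #> (b [^] q))"
      unfolding D_def by (auto simp: Q_def carrier_FactGroup image_iff simp flip: pow_Q)
    also have "\<dots> \<longleftrightarrow> (\<exists>b\<in>carrier G. a \<otimes> inv (b [^] q) \<in> qF)"
      using a by (simp add: r_coset_eq_iff[OF qF])
    also have "\<dots> \<longleftrightarrow> a \<in> multiples G q (carrier G)"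
    proof
      assume "\<exists>b\<in>carrier G. a \<otimes> inv (b [^] q) \<in> qF"
      then obtain b f where bf: "b \<in> carrier G" "f \<in> F" "a \<otimes> inv (b [^] q) = f [^] q"
        by (auto simp: qF_def multiples_def)
      then have f: "f \<in> carrier G" using F subgroup.subset by blast
      have "a = f [^] q \<otimes> b [^] q" using a bf f by (metis inv_solve_right nat_pow_closed)
      also have "\<dots> = (f \<otimes> b) [^] q" using f bf by (simp add: nat_pow_distrib)
      finally show "a \<in> multiples G q (carrier G)" using f bf by (auto simp: multiples_def)
    next
      assume "a \<in> multiples G q (carrier G)"
      then show "\<exists>b\<in>carrier G. a \<otimes> inv (b [^] q) \<in> qF"
        using subgroup.one_closed[OF qF] by (force simp: multiples_def)
    qed
    finally show "qF #> a \<in> D \<longleftrightarrow> a \<in> multiples G q (carrier G)" .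
  qed
  moreover have "card (carrier (Q Mod D)) * card D = card (carrier Q)"
    using Q.lagrange[OF D] unfolding FactGroup_def order_def by simp
  moreover have "card (kernel Q Q (\<lambda>Y. Y [^]\<^bsub>Q\<^esub> q)) * card D = card (carrier Q)"
    unfolding D_def
    by (rule group_hom.card_kernel_times_image[OF Q.power_group_hom fin])
  moreover have "card D > 0"
    unfolding D_def using fin by (auto simp: card_gt_0_iff)
  moreover have "card (kernel Q Q (\<lambda>Y. Y [^]\<^bsub>Q\<^esub> q)) = q ^ card J * card {a \<in> carrier G. a [^] q = \<one>}"
  proof -
    let ?C = "\<Pi>\<^sub>E j\<in>J. {0..<int q}" and ?t = "{a \<in> carrier G. a [^] q = \<one>}"
    let ?h = "\<lambda>(c, t). qF #> (lincomb G x J c \<otimes> t)"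
    \<comment> \<open>The decomposition of Q[q] as an explicit bijection: a coefficient vector
      modulo \<open>q\<close> stands for an element of F/qF and is paired with an element of
      G[q].\<close>
    have "bij_betw ?h (?C \<times> ?t) (kernel Q Q (\<lambda>Y. Y [^]\<^bsub>Q\<^esub> q))"
      unfolding bij_betw_def
    proof
      show "inj_on ?h (?C \<times> ?t)"
      proof (rule inj_onI, clarify)
        fix c t d u
        assume c: "c \<in> ?C" and d: "d \<in> ?C" and t: "t \<in> carrier G" "t [^] q = \<one>"
          and u: "u \<in> carrier G" "u [^] q = \<one>"
          and eq: "qF #> (lincomb G x J c \<otimes> t) = qF #> (lincomb G x J d \<otimes> u)"
        have "(lincomb G x J c \<otimes> t) \<otimes> inv (lincomb G x J d \<otimes> u) \<in> qF"
          using eq t u J by (simp add: r_coset_eq_iff[OF qF])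
        also have "(lincomb G x J c \<otimes> t) \<otimes> inv (lincomb G x J d \<otimes> u)
            = lincomb G x J (\<lambda>j. c j - d j) \<otimes> (t \<otimes> inv u)"
          using J t u by (simp add: lincomb_diff inv_mult m_ac)
        finally obtain e where e: "lincomb G x J (\<lambda>j. c j - d j) \<otimes> (t \<otimes> inv u)
            = lincomb G x J (\<lambda>j. int q * e j)" by (auto simp: qF_eq)
        have tu: "(t \<otimes> inv u) [^] q = \<one>" using t u by (simp add: nat_pow_distrib nat_pow_inv)
        \<comment> \<open>Multiplication by \<open>q\<close> kills the torsion part, so independence
          allows the coefficients to be compared.\<close>
        have "lincomb G x J (\<lambda>j. int q * (c j - d j)) = lincomb G x J (\<lambda>j. int q * (int q * e j))"
          using arg_cong[OF e, of "\<lambda>a. a [^] q"] J t u tu by (simp add: nat_pow_distrib pow_lc)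
        then have "int q * (c j - d j) = int q * (int q * e j)" if "j \<in> J" for j
          using independent_family_lincomb_inj[OF ind _ that] by blast
        then have *: "c j - d j = int q * e j" if "j \<in> J" for j using that \<open>q > 0\<close> by simp
        have cd: "c j = d j" if "j \<in> J" for j
        proof -
          have "c j \<in> {0..<int q}" "d j \<in> {0..<int q}" using c d that by auto
          then have "c j mod int q = c j" "d j mod int q = d j" by auto
          moreover have "c j mod int q = d j mod int q" using *[OF that] by (simp add: mod_eq_dvd_iff)
          ultimately show ?thesis by linarith
        qed
        then have "c = d" using c d by (metis PiE_ext)
        have "lincomb G x J (\<lambda>j. c j - d j) = \<one>" using cd by (intro lincomb_zero) simp
        moreover have "lincomb G x J (\<lambda>j. int q * e j) = \<one>" using cd * by (intro lincomb_zero) simp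
        ultimately have "t \<otimes> inv u = \<one>" using e t u by simp
        then have "t = u" using t u by (metis inv_equality inv_closed inv_inv)
        with \<open>c = d\<close> show "c = d \<and> t = u" by simp
      qed
      show "?h ` (?C \<times> ?t) = kernel Q Q (\<lambda>Y. Y [^]\<^bsub>Q\<^esub> q)"
      proof (intro equalityI subsetI)
        fix Y assume "Y \<in> ?h ` (?C \<times> ?t)"
        then obtain c t where ct: "c \<in> ?C" "t \<in> carrier G" "t [^] q = \<one>"
          and Y: "Y = qF #> (lincomb G x J c \<otimes> t)" by auto
        have "(lincomb G x J c \<otimes> t) [^] q \<in> qF"
          using J ct by (auto simp: nat_pow_distrib pow_lc qF_eq)
        then have "Y [^]\<^bsub>Q\<^esub> q = qF"
          using Y J ct by (simp add: pow_Q r_coset_eq_self_iff[OF qF])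
        then show "Y \<in> kernel Q Q (\<lambda>Y. Y [^]\<^bsub>Q\<^esub> q)"
          using J ct Y by (auto simp: kernel_def one_Q) (auto simp: Q_def carrier_FactGroup)
      next
        fix Y assume "Y \<in> kernel Q Q (\<lambda>Y. Y [^]\<^bsub>Q\<^esub> q)"
        then have "Y \<in> (\<lambda>a. qF #> a) ` carrier G" "Y [^]\<^bsub>Q\<^esub> q = qF"
          by (simp_all only: kernel_def one_Q mem_Collect_eq) (simp only: Q_def carrier_FactGroup)
        then obtain a where a: "a \<in> carrier G" "Y = qF #> a" "(qF #> a) [^]\<^bsub>Q\<^esub> q = qF" by blast
        then have "a [^] q \<in> qF" by (simp add: pow_Q r_coset_eq_self_iff[OF qF])
        then obtain e where e: "a [^] q = lincomb G x J e [^] q" by (auto simp: qF_eq pow_lc)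
        \<comment> \<open>Since \<open>a\<close> and the combination with coefficients
          \<open>e\<close> have the same \<open>q\<close>-th multiple, their difference is
          \<open>q\<close>-torsion; \<open>c\<close> is \<open>e\<close> reduced modulo
          \<open>q\<close>.\<close>
        define t where "t = a \<otimes> inv (lincomb G x J e)"
        define c where "c = (\<lambda>j\<in>J. e j mod int q)"
        have t: "t \<in> ?t" using a J e by (simp add: t_def nat_pow_distrib nat_pow_inv)
        have "lincomb G x J c = lincomb G x J (\<lambda>j. e j mod int q)"
          using J by (intro lincomb_cong) (auto simp: c_def)
        moreover have cancel: "a \<otimes> (inv a \<otimes> z) = z" if "z \<in> carrier G" for z
          using a that by (simp flip: m_assoc)
        ultimately have "a \<otimes> inv (lincomb G x J c \<otimes> t)
            = lincomb G x J e \<otimes> inv (lincomb G x J (\<lambda>j. e j mod int q))"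
          using a J by (simp add: cancel t_def inv_mult m_ac)
        also have "\<dots> = lincomb G x J (\<lambda>j. int q * (e j div int q))"
          using lincomb_diff[OF J(2), of e "\<lambda>j. e j mod int q"] by (simp only: minus_mod_eq_mult_div)
        also have "\<dots> \<in> qF" unfolding qF_eq by (rule rangeI)
        finally have "Y = qF #> (lincomb G x J c \<otimes> t)"
          using a J t by (simp add: r_coset_eq_iff[OF qF])
        moreover have "c \<in> ?C" using \<open>q > 0\<close> by (auto simp: c_def)
        ultimately show "Y \<in> ?h ` (?C \<times> ?t)" using t by (auto intro!: image_eqI[of _ _ "(c, t)"])
      qed
    qed
    then have "card (kernel Q Q (\<lambda>Y. Y [^]\<^bsub>Q\<^esub> q)) = card (?C \<times> ?t)"
      by (simp add: bij_betw_same_card)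
    then show ?thesis using J by (simp add: card_cartesian_product card_PiE)
  qed
  ultimately show ?thesis by (metis mult_cancel2 less_numeral_extra(3))
qed

section \<open>Maximal independent families and the rank\<close>

text \<open>\<open>J\<close> is a maximal independent subfamily of \<open>U\<close> containing
  \<open>I\<close>. Adding a further index creates a relation that involves it, so some positive
  multiple of the new element lies in the span of \<open>J\<close>.\<close>

lemma (in comm_group) independent_extension:
  assumes "independent_family G x I" "I \<subseteq> U" "finite U" "x ` U \<subseteq> carrier G"
  obtains J where "I \<subseteq> J" "J \<subseteq> U" "independent_family G x J"
    "x ` U \<subseteq> isolator G (generate G (x ` J))"
proof -
  let ?P = "\<lambda>J. I \<subseteq> J \<and> J \<subseteq> U \<and> independent_family G x J"
  have "finite {J. ?P J}" using assms by (auto intro: finite_subset[of _ "Pow U"])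
  moreover have "{J. ?P J} \<noteq> {}" using assms by auto
  ultimately have "\<exists>J\<in>{J. ?P J}. \<forall>J'\<in>{J. ?P J}. J \<subseteq> J' \<longrightarrow> J = J'"
    by (rule finite_has_maximal)
  then obtain J where J: "?P J" and "\<forall>J'\<in>{J. ?P J}. J \<subseteq> J' \<longrightarrow> J = J'" by auto
  then have max: "\<And>J'. ?P J' \<Longrightarrow> J \<subseteq> J' \<Longrightarrow> J' = J" by auto
  have fin: "finite J" "x ` J \<subseteq> carrier G" using J by (auto simp: independent_family_def)
  have gen: "subgroup (generate G (x ` J)) G" using fin by (intro generate_is_subgroup) auto
  have "x u \<in> isolator G (generate G (x ` J))" if u: "u \<in> U" for u
  proof (cases "u \<in> J")
    case True
    then have "x u [^] (1::nat) \<in> generate G (x ` J)"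
      using fin by (simp add: generate.incl image_subset_iff)
    then show ?thesis using u assms(4) unfolding isolator_def by blast
  next
    case False
    then have "\<not> independent_family G x (insert u J)"
      using max[of "insert u J"] J u by auto
    moreover have ins: "finite (insert u J)" "x ` insert u J \<subseteq> carrier G" using fin u assms by auto
    ultimately obtain c where c: "lincomb G x (insert u J) c = \<one>" and nz: "\<exists>j\<in>insert u J. c j \<noteq> 0"
      unfolding independent_family_def by blast
    have eq: "x u [^] c u \<otimes> lincomb G x J c = \<one>"
      using c lincomb_insert[OF fin(1) False ins(2), of c] by simp
    have xu: "x u \<in> carrier G" using ins by simp
    \<comment> \<open>Otherwise the relation would be a nontrivial one over \<open>J\<close>
      alone.\<close>
    have "c u \<noteq> 0"
    proof
      assume "c u = 0"
      then have "lincomb G x J c = \<one>" using eq fin by simp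
      then have "\<forall>j\<in>J. c j = 0" using J unfolding independent_family_def by blast
      then show False using nz \<open>c u = 0\<close> by blast
    qed
    have lc: "lincomb G x J c \<in> generate G (x ` J)" unfolding generate_eq_lincombs[OF fin] by (rule rangeI)
    have "x u [^] c u = inv (lincomb G x J c)" using eq fin xu by (intro inv_equality[symmetric]) auto
    then have "x u [^] c u \<in> generate G (x ` J)" using subgroup.m_inv_closed[OF gen lc] by simp
    \<comment> \<open>Multiplying by the sign makes the exponent positive, as
      \<open>isolator\<close> requires.\<close>
    then have "(x u [^] c u) [^] sgn (c u) \<in> generate G (x ` J)"
      by (rule subgroup_int_pow_closed[OF gen])
    moreover have "c u * sgn (c u) = int (nat \<bar>c u\<bar>)" by (simp flip: abs_sgn)
    ultimately have "x u [^] int (nat \<bar>c u\<bar>) \<in> generate G (x ` J)"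
      using xu by (simp only: int_pow_pow)
    then have "x u [^] nat \<bar>c u\<bar> \<in> generate G (x ` J)" by (simp add: int_pow_int)
    moreover have "nat \<bar>c u\<bar> > 0" using \<open>c u \<noteq> 0\<close> by simp
    ultimately show ?thesis using xu unfolding isolator_def by blast
  qed
  then show thesis using that J by blast
qed

text \<open>Extends \<open>S\<close> inside its union with a finite generating set.\<close>

lemma (in comm_group) finitely_generated_basis_extension:
  assumes "finitely_generated G" "Z_independent G S"
  obtains B where "S \<subseteq> B" "Z_independent G B" "carrier G \<subseteq> isolator G (generate G B)"
proof -
  obtain T where T: "finite T" "T \<subseteq> carrier G" "generate G T = carrier G"
    using assms by (auto simp: finitely_generated_def)
  have S: "finite S" "S \<subseteq> carrier G" using assms by (auto simp: Z_independent_def)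
  obtain B where B: "S \<subseteq> B" "B \<subseteq> S \<union> T" "Z_independent G B"
    "S \<union> T \<subseteq> isolator G (generate G B)"
    using independent_extension[of "\<lambda>s. s" S "S \<union> T"] assms S T
    by (auto simp: Z_independent_iff_family)
  have "subgroup (generate G B) G" using B S T by (intro generate_is_subgroup) auto
  then have "generate G T \<subseteq> isolator G (generate G B)"
    using B by (intro generate_subset_isolator) auto
  then show thesis using B that T by blast
qed

text \<open>The span \<open>F\<close> of a full-rank independent set is free, so it meets the
  torsion trivially. The torsion therefore embeds into the finite quotient
  \<open>G Mod F\<close>.\<close>

lemma (in comm_group) finite_torsion:
  assumes "finitely_generated G"
  shows "finite (torsion G)"
proof -
  have "Z_independent G {}" by (simp add: Z_independent_def)
  then obtain B where B: "Z_independent G B" and iso: "carrier G \<subseteq> isolator G (generate G B)"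
    by (rule finitely_generated_basis_extension[OF assms])
  define F where "F = generate G B"
  have Bfin: "finite B" "B \<subseteq> carrier G" using B by (auto simp: Z_independent_def)
  have F: "subgroup F G" unfolding F_def using Bfin by (intro generate_is_subgroup) auto
  have tors: "subgroup (torsion G) G"
    unfolding torsion_eq_isolator by (intro subgroup_isolator triv_subgroup)
  have "inj_on (\<lambda>a. F #> a) (torsion G)"
  proof (rule inj_onI)
    fix a b assume ab: "a \<in> torsion G" "b \<in> torsion G" "F #> a = F #> b"
    have [simp]: "a \<in> carrier G" "b \<in> carrier G" using ab by (auto simp: torsion_def)
    have "a \<otimes> inv b \<in> F" using ab r_coset_eq_iff[OF F] by simp
    then obtain c where c: "a \<otimes> inv b = lincomb G (\<lambda>s. s) B c"
      using generate_eq_lincombs[of B "\<lambda>s. s"] Bfin by (auto simp: F_def)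
    have "a \<otimes> inv b \<in> torsion G"
      using ab tors by (simp add: subgroup.m_closed subgroup.m_inv_closed)
    then obtain n :: nat where n: "n > 0" "(a \<otimes> inv b) [^] n = \<one>" by (auto simp: torsion_def)
    have "lincomb G (\<lambda>s. s) B (\<lambda>j. int n * c j) = \<one>"
      using n Bfin by (simp add: lincomb_scale int_pow_int flip: c)
    then have "\<forall>j\<in>B. int n * c j = 0"
      using B unfolding Z_independent_iff_family independent_family_def by blast
    then have "a \<otimes> inv b = \<one>" unfolding c using n by (intro lincomb_zero) auto
    then show "a = b" by (metis \<open>a \<in> carrier G\<close> \<open>b \<in> carrier G\<close> inv_closed inv_equality inv_inv)
  qed
  moreover have "finite ((\<lambda>a. F #> a) ` torsion G)"
    using finite_Mod_isolated[OF assms F] iso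
    by (rule_tac finite_subset[of _ "carrier (G Mod F)"]) (auto simp: F_def carrier_FactGroup torsion_def)
  ultimately show ?thesis by (rule finite_imageD[rotated])
qed

lemma (in comm_group) finite_power_kernel:
  assumes "finitely_generated G" "q > 0"
  shows "finite {a \<in> carrier G. a [^] (q::nat) = \<one>}"
  by (rule finite_subset[OF _ finite_torsion[OF assms(1)]]) (use assms(2) in \<open>auto simp: torsion_def\<close>)

text \<open>Invariance of the rank: taking \<open>q = 2\<close> in
  \<open>card_Mod_multiples\<close>, both 2^|J| and 2^|K| equal [G : 2G] / |G[2]|.\<close>

lemma (in comm_group) card_independent_unique:
  assumes "finitely_generated G"
    and "independent_family G x J" "carrier G \<subseteq> isolator G (generate G (x ` J))"
    and "independent_family G y K" "carrier G \<subseteq> isolator G (generate G (y ` K))"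
  shows "card J = card K"
proof -
  have "finite {a \<in> carrier G. a [^] (2::nat) = \<one>}"
    using assms(1) by (rule finite_power_kernel) simp
  then have "card {a \<in> carrier G. a [^] (2::nat) = \<one>} \<noteq> 0"
    by (auto simp: card_eq_0_iff intro!: exI[of _ \<one>])
  then show ?thesis
    using card_Mod_multiples[OF assms(1-3), of 2] card_Mod_multiples[OF assms(1,4,5), of 2] by simp
qed

text \<open>Every independent set extends to one of full rank, whose size must be
  \<open>card J\<close>. This also bounds the sizes, so that \<open>Max\<close> is taken over a
  finite set.\<close>

lemma (in comm_group) group_rank_carrier_eq:
  assumes "finitely_generated G" "independent_family G x J"
    and "carrier G \<subseteq> isolator G (generate G (x ` J))"
  shows "group_rank G (carrier G) = card J"
  unfolding group_rank_def
proof (rule Max_eqI)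
  have xJ: "inj_on x J" "Z_independent G (x ` J)"
    using independent_family_imp_Z_independent[OF assms(2)] by auto
  then show "card J \<in> {card S |S. S \<subseteq> carrier G \<and> Z_independent G S}"
    by (auto simp: Z_independent_def card_image intro!: exI[of _ "x ` J"])
  show le: "k \<le> card J" if "k \<in> {card S |S. S \<subseteq> carrier G \<and> Z_independent G S}" for k
  proof -
    from that obtain S where S: "k = card S" "Z_independent G S" by auto
    obtain B where B: "S \<subseteq> B" "Z_independent G B" "carrier G \<subseteq> isolator G (generate G B)"
      using finitely_generated_basis_extension[OF assms(1) S(2)] by blast
    have "card B = card J"
      using card_independent_unique[of "\<lambda>s. s" B x J] assms B by (simp add: Z_independent_iff_family)
    moreover have "card S \<le> card B" using B by (intro card_mono) (auto simp: Z_independent_def)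
    ultimately show ?thesis using S by simp
  qed
  show "finite {card S |S. S \<subseteq> carrier G \<and> Z_independent G S}"
  proof (rule finite_subset)
    show "{card S |S. S \<subseteq> carrier G \<and> Z_independent G S} \<subseteq> {..card J}"
      using le by (intro subsetI) (simp only: atMost_iff)
  qed simp
qed

text \<open>The generated subgroup is viewed as a group of its own, where independence, spans and
  multiples are the same as in \<open>G\<close>; then the statement for a whole carrier
  applies.\<close>

lemma (in comm_group) group_rank_generate_eq:
  assumes "finite T" "T \<subseteq> carrier G" "independent_family G x J" "x ` J \<subseteq> generate G T"
    and "T \<subseteq> isolator G (generate G (x ` J))"
  shows "group_rank G (generate G T) = card J"
proof -
  define H where "H = generate G T"
  define G' where "G' = G\<lparr>carrier := H\<rparr>"
  have H: "subgroup H G" unfolding H_def using assms(2) by (rule generate_is_subgroup)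
  interpret G': comm_group G' unfolding G'_def by (rule comm_group_subgroup[OF H])
  have TH: "T \<subseteq> H" unfolding H_def using assms by (auto intro: generate.incl)
  have HG: "H \<subseteq> carrier G" using subgroup.subset[OF H] .
  have gen: "generate G' U = generate G U" if "U \<subseteq> H" for U
    unfolding G'_def using generate_consistent[OF that H] by simp
  have "group_rank G H = group_rank G' (carrier G')"
  proof -
    have "S \<subseteq> H \<and> Z_independent G S \<longleftrightarrow> S \<subseteq> H \<and> Z_independent G' S" for S
      unfolding Z_independent_iff_family independent_family_def G'_def
      using lincomb_subgroup[OF H, of "\<lambda>s. s" S] HG by auto
    then show ?thesis unfolding group_rank_def by (simp add: G'_def)
  qed
  also have "\<dots> = card J"
  proof (rule G'.group_rank_carrier_eq)
    show "finitely_generated G'"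
      unfolding finitely_generated_def using assms(1) TH gen[OF TH] by (auto simp: G'_def H_def)
    show "independent_family G' x J"
      using assms(3,4) lincomb_subgroup[OF H, of x J] unfolding independent_family_def
      by (simp add: G'_def H_def)
    have "subgroup (generate G (x ` J)) G"
      using assms(3) by (intro generate_is_subgroup) (auto simp: independent_family_def)
    then have "H \<subseteq> isolator G (generate G (x ` J))"
      unfolding H_def using assms(5) by (rule generate_subset_isolator)
    then show "carrier G' \<subseteq> isolator G' (generate G' (x ` J))"
      using gen[of "x ` J"] assms(4) nat_pow_consistent[of _ _ H]
      by (auto simp: isolator_def G'_def H_def)
  qed
  finally show ?thesis unfolding H_def .
qed

section \<open>Indices of the subgroups \<open>\<langle>\<L>\<^sub>A\<rangle> + qG\<close>\<close>

lemma (in comm_group) coset_group_hom: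
  assumes "subgroup H G"
  shows "group_hom G (G Mod H) (\<lambda>a. H #> a)"
  using assms normal.r_coset_hom_Mod[of H G] comm_group.axioms(2)[OF abelian_FactGroup[OF assms]]
  by (simp add: group_hom_def group_hom_axioms_def is_group normal_iff_subgroup)

lemma (in comm_group) nat_pow_FactGroup:
  assumes "subgroup H G" "a \<in> carrier G"
  shows "(H #> a) [^]\<^bsub>G Mod H\<^esub> (n::nat) = H #> (a [^] n)"
  using assms by (intro normal.FactGroup_pow) (simp_all add: normal_iff_subgroup)

lemma (in comm_group) FactGroup_nat_pow_eq_one_iff:
  assumes "subgroup H G" "a \<in> carrier G"
  shows "(H #> a) [^]\<^bsub>G Mod H\<^esub> (n::nat) = \<one>\<^bsub>G Mod H\<^esub> \<longleftrightarrow> a [^] n \<in> H"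
  using assms by (simp add: nat_pow_FactGroup r_coset_eq_self_iff)

lemma (in comm_group) finitely_generated_FactGroup:
  assumes "finitely_generated G" "subgroup H G"
  shows "finitely_generated (G Mod H)"
proof -
  obtain T where T: "finite T" "T \<subseteq> carrier G" "generate G T = carrier G"
    using assms by (auto simp: finitely_generated_def)
  have "generate (G Mod H) ((\<lambda>a. H #> a) ` T) = (\<lambda>a. H #> a) ` generate G T"
    using group_hom.generate_img[OF coset_group_hom[OF assms(2)] T(2)] by simp
  then show ?thesis
    using T unfolding finitely_generated_def carrier_FactGroup by (metis finite_imageI image_mono)
qed

text \<open>A maximal independent part \<open>S\<close> of the list over \<open>A\<close> is
  extended to a full-rank independent set \<open>B\<close> of \<open>G\<close>. The elements of
  \<open>B - S\<close> stay independent and of full rank in \<open>K\<close>, so rk(K) = rk(G) -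
  rk(H), and \<open>card_Mod_multiples\<close> applies to \<open>K\<close>. The factor with rk(H)
  stands on the left to avoid subtraction.\<close>

lemma (in comm_group) card_FactGroup_Mod_multiples:
  assumes fg: "finitely_generated G" and A: "finite A" "x ` A \<subseteq> carrier G" and "q > 0"
  defines "H \<equiv> generate G (x ` A)"
  defines "K \<equiv> G Mod H"
  shows "card (carrier (K Mod multiples K q (carrier K))) * q ^ group_rank G H
       = q ^ group_rank G (carrier G) * card {Y \<in> carrier K. Y [^]\<^bsub>K\<^esub> q = \<one>\<^bsub>K\<^esub>}"
proof -
  have "independent_family G x {}" by (simp add: independent_family_def)
  then obtain I where I: "I \<subseteq> A" "independent_family G x I" "x ` A \<subseteq> isolator G (generate G (x ` I))"
    using A by (elim independent_extension[of x "{}" A]) auto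
  define S where "S = x ` I"
  have S: "inj_on x I" "Z_independent G S"
    using independent_family_imp_Z_independent[OF I(2)] by (simp_all add: S_def)
  obtain B where B: "S \<subseteq> B" "Z_independent G B" "carrier G \<subseteq> isolator G (generate G B)"
    using S(2) by (rule finitely_generated_basis_extension[OF fg])
  have Bfin: "finite B" "B \<subseteq> carrier G" using B(2) by (auto simp: Z_independent_def)
  have Sfin: "finite S" "S \<subseteq> carrier G" using B(1) Bfin finite_subset by auto
  have indB: "independent_family G (\<lambda>b. b) B" using B(2) by (simp add: Z_independent_iff_family)
  have H: "subgroup H G" unfolding H_def using A(2) by (rule generate_is_subgroup)
  have SH: "S \<subseteq> H" unfolding S_def H_def using I(1) by (auto intro: generate.incl)
  have genS: "subgroup (generate G S) G" using Sfin(2) by (rule generate_is_subgroup)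
  have genSH: "generate G S \<subseteq> H" using SH H by (rule generate_subgroup_incl)
  have Hiso: "H \<subseteq> isolator G (generate G S)"
    unfolding H_def using genS I(3) unfolding S_def by (rule generate_subset_isolator)
  have rkG: "group_rank G (carrier G) = card B"
    using group_rank_carrier_eq[OF fg indB] B(3) by simp
  have rkH: "group_rank G H = card S"
    unfolding H_def using A SH S(1) group_rank_generate_eq[OF _ A(2) I(2) _ I(3)]
    by (simp add: S_def H_def card_image)
  define J where "J = B - S"
  have J: "finite J" "J \<subseteq> carrier G" "J \<subseteq> B" "J \<inter> S = {}" using Bfin by (auto simp: J_def)
  have cardB: "card B = card J + card S"
    using Bfin Sfin B(1) unfolding J_def by (simp add: card_Diff_subset card_mono)
  have split: "lincomb G (\<lambda>b. b) B c = lincomb G (\<lambda>b. b) S c \<otimes> lincomb G (\<lambda>b. b) J c" for c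
  proof -
    have "B = S \<union> J" using B(1) by (auto simp: J_def)
    then show ?thesis
      unfolding lincomb_def using J Sfin by (simp only:) (rule finprod_Un_disjoint, auto)
  qed
  interpret K: comm_group K unfolding K_def by (rule abelian_FactGroup[OF H])
  have hom: "(\<lambda>a. H #> a) \<in> hom G K"
    unfolding K_def using group_hom.homh[OF coset_group_hom[OF H]] .
  have lcK: "lincomb K (\<lambda>b. H #> b) J c = H #> lincomb G (\<lambda>b. b) J c" for c
    using lincomb_hom[OF comm_group_axioms K.comm_group_axioms hom, of "\<lambda>b. b" J c] J by simp
  have carK: "carrier K = (\<lambda>a. H #> a) ` carrier G" by (simp add: K_def carrier_FactGroup)
  have imJ: "(\<lambda>b. H #> b) ` J \<subseteq> carrier K" using J by (auto simp: carK)
  have oneK: "\<one>\<^bsub>K\<^esub> = H" by (simp add: K_def)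
  have "independent_family K (\<lambda>b. H #> b) J"
    unfolding independent_family_def
  proof (intro conjI allI impI ballI J(1) imJ)
    fix c j assume c: "lincomb K (\<lambda>b. H #> b) J c = \<one>\<^bsub>K\<^esub>" and j: "j \<in> J"
    define y where "y = lincomb G (\<lambda>b. b) J c"
    have y: "y \<in> carrier G" using J by (simp add: y_def)
    then have "y \<in> H" using c by (simp add: lcK oneK r_coset_eq_self_iff[OF H] y_def)
    then obtain n :: nat where n: "n > 0" "y [^] n \<in> generate G S"
      using Hiso by (auto simp: isolator_def)
    then obtain d where d: "y [^] n = lincomb G (\<lambda>b. b) S d"
      using generate_eq_lincombs[of S "\<lambda>b. b"] Sfin by auto
    \<comment> \<open>A multiple of the combination over \<open>J\<close> is a combination over
      \<open>S\<close>; moving everything to one side gives a relation \<open>e\<close> over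
      \<open>B\<close>.\<close>
    define e where "e = (\<lambda>b. if b \<in> J then int n * c b else - d b)"
    have "lincomb G (\<lambda>b. b) S e = lincomb G (\<lambda>b. b) S (\<lambda>b. (-1) * d b)"
      using J(4) Sfin by (intro lincomb_cong) (auto simp: e_def)
    also have "\<dots> = inv (y [^] n)"
      using Sfin by (subst lincomb_scale) (auto simp: d int_pow_neg)
    finally have 1: "lincomb G (\<lambda>b. b) S e = inv (y [^] n)" .
    have "lincomb G (\<lambda>b. b) J e = lincomb G (\<lambda>b. b) J (\<lambda>b. int n * c b)"
      using J by (intro lincomb_cong) (auto simp: e_def)
    also have "\<dots> = y [^] n"
      using J by (subst lincomb_scale) (auto simp: y_def int_pow_int)
    finally have "lincomb G (\<lambda>b. b) B e = \<one>" using 1 y by (simp add: split)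
    then have "e j = 0" using indB j J(3) unfolding independent_family_def by blast
    then show "c j = 0" using n j by (simp add: e_def)
  qed
  moreover have "carrier K \<subseteq> isolator K (generate K ((\<lambda>b. H #> b) ` J))"
  proof
    fix Y assume Y: "Y \<in> carrier K"
    then obtain a where a: "a \<in> carrier G" "Y = H #> a" by (auto simp: carK)
    then obtain n :: nat where n: "n > 0" "a [^] n \<in> generate G B"
      using B(3) by (auto simp: isolator_def)
    then obtain c where c: "a [^] n = lincomb G (\<lambda>b. b) B c"
      using generate_eq_lincombs[of B "\<lambda>b. b"] Bfin by auto
    have "lincomb G (\<lambda>b. b) S c \<in> H"
      using generate_eq_lincombs[of S "\<lambda>b. b"] Sfin genSH by auto
    \<comment> \<open>Modulo \<open>H\<close> the part of the combination over \<open>S\<close>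
      disappears.\<close>
    then have "H #> (a [^] n) = H #> lincomb G (\<lambda>b. b) J c"
      using a J Sfin unfolding c by (subst r_coset_eq_iff[OF H]) (simp_all add: split m_assoc)
    then have "Y [^]\<^bsub>K\<^esub> n = lincomb K (\<lambda>b. H #> b) J c"
      unfolding a(2) lcK by (simp add: K_def nat_pow_FactGroup[OF H a(1)])
    also have "\<dots> \<in> generate K ((\<lambda>b. H #> b) ` J)"
      unfolding K.generate_eq_lincombs[OF J(1) imJ] by (rule rangeI)
    finally show "Y \<in> isolator K (generate K ((\<lambda>b. H #> b) ` J))"
      using Y n(1) unfolding isolator_def by blast
  qed
  moreover have "finitely_generated K"
    unfolding K_def by (rule finitely_generated_FactGroup[OF fg H])
  ultimately have "card (carrier (K Mod multiples K q (carrier K)))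
      = q ^ card J * card {Y \<in> carrier K. Y [^]\<^bsub>K\<^esub> q = \<one>\<^bsub>K\<^esub>}"
    using \<open>q > 0\<close> by (intro K.card_Mod_multiples)
  then show ?thesis by (simp add: rkG rkH cardB power_add)
qed

section \<open>The subgroup H + qG: its index, flows and homomorphisms\<close>

text \<open>For a subgroup \<open>H\<close> this is H + qG. Membership has the form that equality of
  \<open>H\<close>-cosets takes after unfolding.\<close>

definition plus_multiples :: "('g, 'b) monoid_scheme \<Rightarrow> 'g set \<Rightarrow> nat \<Rightarrow> 'g set" where
  "plus_multiples G H q = {a \<in> carrier G. \<exists>b\<in>carrier G. a \<otimes>\<^bsub>G\<^esub> inv\<^bsub>G\<^esub> (b [^]\<^bsub>G\<^esub> q) \<in> H}"

lemma (in comm_group) subgroup_plus_multiples: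
  assumes H: "subgroup H G"
  shows "subgroup (plus_multiples G H q) G"
proof
  show "plus_multiples G H q \<subseteq> carrier G" by (auto simp: plus_multiples_def)
  show "\<one> \<in> plus_multiples G H q"
    using subgroup.one_closed[OF H] by (auto simp: plus_multiples_def intro!: bexI[of _ \<one>])
next
  fix a assume "a \<in> plus_multiples G H q"
  then obtain b where b: "a \<in> carrier G" "b \<in> carrier G" "a \<otimes> inv (b [^] q) \<in> H"
    by (auto simp: plus_multiples_def)
  then have "inv (a \<otimes> inv (b [^] q)) \<in> H" using H by (simp add: subgroup.m_inv_closed)
  also have "inv (a \<otimes> inv (b [^] q)) = inv a \<otimes> inv (inv b [^] q)"
    using b by (simp add: inv_mult nat_pow_inv)
  finally show "inv a \<in> plus_multiples G H q"
    using b unfolding plus_multiples_def by blast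
next
  fix a c assume "a \<in> plus_multiples G H q" "c \<in> plus_multiples G H q"
  then obtain b d where bd: "a \<in> carrier G" "b \<in> carrier G" "a \<otimes> inv (b [^] q) \<in> H"
      "c \<in> carrier G" "d \<in> carrier G" "c \<otimes> inv (d [^] q) \<in> H"
    by (auto simp: plus_multiples_def)
  then have "(a \<otimes> inv (b [^] q)) \<otimes> (c \<otimes> inv (d [^] q)) \<in> H" using H by (simp add: subgroup.m_closed)
  also have "(a \<otimes> inv (b [^] q)) \<otimes> (c \<otimes> inv (d [^] q)) = (a \<otimes> c) \<otimes> inv ((b \<otimes> d) [^] q)"
    using bd by (simp add: inv_mult nat_pow_distrib m_ac)
  finally have "(a \<otimes> c) \<otimes> inv ((b \<otimes> d) [^] q) \<in> H" .
  moreover have "a \<otimes> c \<in> carrier G" "b \<otimes> d \<in> carrier G" using bd by auto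
  ultimately show "a \<otimes> c \<in> plus_multiples G H q"
    unfolding plus_multiples_def by blast
qed

lemma (in comm_group) pow_in_plus_multiples:
  assumes "subgroup H G" "a \<in> carrier G"
  shows "a [^] q \<in> plus_multiples G H q"
  using assms subgroup.one_closed[OF assms(1)] by (auto simp: plus_multiples_def intro!: bexI[of _ a])

lemma (in comm_group) subset_plus_multiples:
  assumes "subgroup H G"
  shows "H \<subseteq> plus_multiples G H q"
  using subgroup.subset[OF assms] by (auto simp: plus_multiples_def intro!: bexI[of _ \<one>])

text \<open>H + qG is the preimage in \<open>G\<close> of the \<open>q\<close>-multiples of
  \<open>G Mod H\<close>.\<close>

lemma (in comm_group) card_Mod_plus_multiples:
  assumes H: "subgroup H G"
  shows "card (carrier (G Mod plus_multiples G H q))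
       = card (carrier ((G Mod H) Mod multiples (G Mod H) q (carrier (G Mod H))))"
proof -
  interpret K: comm_group "G Mod H" by (rule abelian_FactGroup[OF H])
  have "H #> a \<in> multiples (G Mod H) q (carrier (G Mod H)) \<longleftrightarrow> a \<in> plus_multiples G H q"
    if a: "a \<in> carrier G" for a
  proof -
    have "multiples (G Mod H) q (carrier (G Mod H)) = (\<lambda>b. H #> (b [^] q)) ` carrier G"
      unfolding multiples_def carrier_FactGroup image_image
      by (intro image_cong refl nat_pow_FactGroup[OF H])
    then show ?thesis
      using a by (auto simp: plus_multiples_def image_iff r_coset_eq_iff[OF H])
  qed
  then show ?thesis
    using card_iterated_Mod[OF H K.subgroup_multiples[OF K.subgroup_self]
        subgroup_plus_multiples[OF H], of q q] by simp
qed

text \<open>Let \<open>D\<close> be the image of the span \<open>H\<close> in G/qG. Counting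
  relations gives q^|A| as their number times |D|, and [G : qG] is [G : H + qG] times |D|; combining
  the two gives the identity.\<close>

lemma (in comm_group) card_relations_mod_multiples:
  assumes fg: "finitely_generated G" and A: "finite A" "x ` A \<subseteq> carrier G" and "q > 0"
  defines "qG \<equiv> multiples G q (carrier G)"
  shows "card {c \<in> \<Pi>\<^sub>E j\<in>A. {0..<int q}. lincomb G x A c \<in> qG} * card (carrier (G Mod qG))
       = q ^ card A * card (carrier (G Mod plus_multiples G (generate G (x ` A)) q))"
proof -
  define H where "H = generate G (x ` A)"
  define D where "D = (\<lambda>a. qG #> a) ` H"
  have H: "subgroup H G" unfolding H_def using A(2) by (rule generate_is_subgroup)
  have qG: "subgroup qG G" unfolding qG_def by (rule subgroup_multiples[OF subgroup_self])
  have pow: "a [^] q \<in> qG" if "a \<in> carrier G" for a using that by (simp add: qG_def multiples_def)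
  interpret P: comm_group "G Mod qG" by (rule abelian_FactGroup[OF qG])
  have D: "subgroup D (G Mod qG)"
    unfolding D_def by (rule group_hom.subgroup_img_is_subgroup[OF coset_group_hom[OF qG] H])
  obtain T where "finite T" "T \<subseteq> carrier G" "generate G T = carrier G"
    using fg by (auto simp: finitely_generated_def)
  then have fin: "finite (carrier (G Mod qG))" using finite_Mod[OF qG _ _ _ \<open>q > 0\<close> pow] by blast
  \<comment> \<open>The preimage of \<open>D\<close> in \<open>G\<close> is H + qG, so the quotient
    by \<open>D\<close> has the index of H + qG as its order.\<close>
  have "qG #> a \<in> D \<longleftrightarrow> a \<in> plus_multiples G H q" if a: "a \<in> carrier G" for a
  proof -
    have "qG #> a \<in> D \<longleftrightarrow> (\<exists>h\<in>H. \<exists>b\<in>carrier G. a \<otimes> inv h = b [^] q)"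
      using a subgroup.subset[OF H]
      by (auto simp: D_def image_iff r_coset_eq_iff[OF qG] subset_iff) (auto simp: qG_def multiples_def)
    also have "\<dots> \<longleftrightarrow> (\<exists>b\<in>carrier G. a \<otimes> inv (b [^] q) \<in> H)"
    proof safe
      fix h b assume hb: "h \<in> H" "b \<in> carrier G" "a \<otimes> inv h = b [^] q"
      have h: "h \<in> carrier G" using hb subgroup.subset[OF H] by blast
      have "a \<otimes> inv (b [^] q) = h" using a h by (simp add: inv_mult flip: hb(3)) (simp flip: m_assoc)
      then show "\<exists>b\<in>carrier G. a \<otimes> inv (b [^] q) \<in> H" using hb by blast
    next
      fix b assume b: "b \<in> carrier G" "a \<otimes> inv (b [^] q) \<in> H"
      have "a \<otimes> inv (a \<otimes> inv (b [^] q)) = b [^] q"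
        using a b by (simp add: inv_mult) (simp flip: m_assoc)
      then show "\<exists>h\<in>H. \<exists>b\<in>carrier G. a \<otimes> inv h = b [^] q" using b by blast
    qed
    finally show ?thesis using a by (simp add: plus_multiples_def)
  qed
  then have "card (carrier ((G Mod qG) Mod D)) = card (carrier (G Mod plus_multiples G H q))"
    by (intro card_iterated_Mod qG D subgroup_plus_multiples H)
  moreover have "card (carrier ((G Mod qG) Mod D)) * card D = card (carrier (G Mod qG))"
    using P.lagrange[OF D] unfolding FactGroup_def[of "G Mod qG" D] order_def by simp
  moreover have "card {c \<in> \<Pi>\<^sub>E j\<in>A. {0..<int q}. lincomb G x A c \<in> qG} * card D = q ^ card A"
    unfolding D_def H_def by (rule card_relations_times_image[OF qG A(2,1) \<open>q > 0\<close> pow])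
  moreover have "w * p = r * m" if "i = m" "i * d = p" "w * d = r" for w p r m i d :: nat
    using that by (auto simp: ac_simps)
  ultimately show ?thesis unfolding H_def by blast
qed

text \<open>A homomorphism to Z/q kills qG, so vanishing on the listed elements means vanishing on H
  + qG. That subgroup contains all \<open>q\<close>-multiples, and duality applies.\<close>

lemma (in comm_group) card_Hom_vanishing:
  assumes fg: "finitely_generated G" and A: "x ` A \<subseteq> carrier G" and "q > 0"
  shows "card {\<phi> \<in> Hom_set G (integer_mod_group q). \<forall>e\<in>A. \<phi> (x e) = 0}
       = card (carrier (G Mod plus_multiples G (generate G (x ` A)) q))"
proof -
  define H where "H = generate G (x ` A)"
  have H: "subgroup H G" unfolding H_def using A by (rule generate_is_subgroup)
  have "(\<forall>e\<in>A. \<phi> (x e) = 0) \<longleftrightarrow> (\<forall>a\<in>plus_multiples G H q. \<phi> a = 0)"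
    if "\<phi> \<in> Hom_set G (integer_mod_group q)" for \<phi>
  proof
    assume "\<forall>a\<in>plus_multiples G H q. \<phi> a = 0"
    moreover have "x ` A \<subseteq> plus_multiples G H q"
      using subset_plus_multiples[OF H, of q] generate.incl[of _ "x ` A" G] by (auto simp: H_def)
    ultimately show "\<forall>e\<in>A. \<phi> (x e) = 0" by blast
  next
    assume *: "\<forall>e\<in>A. \<phi> (x e) = 0"
    interpret \<phi>: group_hom G "integer_mod_group q" \<phi>
      using that by (simp add: Hom_set_def group_hom_def group_hom_axioms_def is_group)
    have "x ` A \<subseteq> kernel G (integer_mod_group q) \<phi>" using * A by (auto simp: kernel_def)
    then have ker: "H \<subseteq> kernel G (integer_mod_group q) \<phi>"
      unfolding H_def by (rule generate_subgroup_incl[OF _ \<phi>.subgroup_kernel])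
    show "\<forall>a\<in>plus_multiples G H q. \<phi> a = 0"
    proof
      fix a assume "a \<in> plus_multiples G H q"
      then obtain b where b: "a \<in> carrier G" "b \<in> carrier G" "a \<otimes> inv (b [^] q) \<in> H"
        by (auto simp: plus_multiples_def)
      have "\<phi> (b [^] q) = 0" using b(2) \<phi>.hom_nat_pow[of b q] by simp
      then have "b [^] q \<in> kernel G (integer_mod_group q) \<phi>" using b by (simp add: kernel_def)
      moreover have "a \<otimes> inv (b [^] q) \<in> kernel G (integer_mod_group q) \<phi>" using b ker by blast
      ultimately have "a \<otimes> inv (b [^] q) \<otimes> b [^] q \<in> kernel G (integer_mod_group q) \<phi>"
        using subgroup.m_closed[OF \<phi>.subgroup_kernel] by blast
      then show "\<phi> a = 0" using b by (simp add: m_assoc kernel_def)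
    qed
  qed
  then have "{\<phi> \<in> Hom_set G (integer_mod_group q). \<forall>e\<in>A. \<phi> (x e) = 0}
      = {\<phi> \<in> Hom_set G (integer_mod_group q). \<forall>a\<in>plus_multiples G H q. \<phi> a = 0}" by blast
  also have "card \<dots> = card (carrier (G Mod plus_multiples G H q))"
    by (rule card_Hom_annihilating[OF fg subgroup_plus_multiples[OF H] \<open>q > 0\<close> pow_in_plus_multiples[OF H]])
  finally show ?thesis unfolding H_def .
qed

lemma (in comm_group) card_Mod_multiples_rank:
  assumes "finitely_generated G" "q > 0"
  shows "card (carrier (G Mod multiples G q (carrier G)))
       = q ^ group_rank G (carrier G) * card {a \<in> carrier G. a [^] q = \<one>}"
proof -
  have "Z_independent G {}" by (simp add: Z_independent_def)
  then obtain B where B: "Z_independent G B" "carrier G \<subseteq> isolator G (generate G B)"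
    by (rule finitely_generated_basis_extension[OF assms(1)])
  then show ?thesis
    using card_Mod_multiples[of "\<lambda>b. b" B q] group_rank_carrier_eq[of "\<lambda>b. b" B] assms
    by (simp add: Z_independent_iff_family)
qed

text \<open>Kernel times image for multiplication by \<open>q\<close> on the torsion subgroup, whose
  kernel is all of G[q] because \<open>q > 0\<close>.\<close>

lemma (in comm_group) card_torsion_eq:
  assumes "finitely_generated G" "q > 0"
  shows "card (torsion G) = card {a \<in> carrier G. a [^] q = \<one>} * card (multiples G q (torsion G))"
proof -
  have tors: "subgroup (torsion G) G"
    unfolding torsion_eq_isolator by (intro subgroup_isolator triv_subgroup)
  interpret T: comm_group "G\<lparr>carrier := torsion G\<rparr>" by (rule comm_group_subgroup[OF tors])
  interpret p: group_hom "G\<lparr>carrier := torsion G\<rparr>" G "\<lambda>a. a [^] q"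
    using subgroup.subset[OF tors] T.is_group is_group
    by (auto simp: group_hom_def group_hom_axioms_def hom_def nat_pow_distrib subset_iff)
  have "kernel (G\<lparr>carrier := torsion G\<rparr>) G (\<lambda>a. a [^] q) = {a \<in> carrier G. a [^] q = \<one>}"
    using assms(2) by (auto simp: kernel_def torsion_def)
  then show ?thesis
    using p.card_kernel_times_image finite_torsion[OF assms(1)] by (simp add: multiples_def)
qed

section \<open>Bases and torsion\<close>

lemma (in comm_group) torsion_FactGroup:
  assumes "subgroup H G"
  shows "torsion (G Mod H) = (\<lambda>a. H #> a) ` isolator G H"
  unfolding torsion_def isolator_def carrier_FactGroup
  using FactGroup_nat_pow_eq_one_iff[OF assms] by blast

lemma (in comm_group) list_mult_empty: "list_mult G g {} = card (torsion G)"
proof -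
  have triv: "subgroup {\<one>} G" by (rule triv_subgroup)
  have "inj_on (\<lambda>a. {\<one>} #> a) (torsion G)"
  proof (rule inj_onI)
    fix a b assume "a \<in> torsion G" "b \<in> torsion G" "{\<one>} #> a = {\<one>} #> b"
    then have "a \<in> carrier G" "b \<in> carrier G" "a \<otimes> inv b = \<one>"
      using r_coset_eq_iff[OF triv] by (auto simp: torsion_def)
    then show "a = b" by (metis inv_closed inv_equality inv_inv)
  qed
  then show ?thesis
    unfolding list_mult_def list_torsion_def list_span_def
    by (simp add: generate_empty torsion_FactGroup[OF triv] card_image flip: torsion_eq_isolator)
qed

lemma (in comm_group) list_rk_independent:
  assumes "independent_family G g J"
  shows "list_rk G g J = card J"
proof -
  have J: "finite J" "g ` J \<subseteq> carrier G" using assms by (auto simp: independent_family_def)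
  have "g ` J \<subseteq> isolator G (generate G (g ` J))"
    using J generate.incl[of _ "g ` J" G] by (auto simp: isolator_def intro!: exI[of _ 1])
  then show ?thesis
    unfolding list_rk_def list_span_def
    using J assms generate.incl[of _ "g ` J" G] by (intro group_rank_generate_eq) blast+
qed

lemma (in comm_group) list_rk_basis:
  assumes "finite U" "g ` U \<subseteq> carrier G" "J \<subseteq> U" "independent_family G g J"
    and "g ` U \<subseteq> isolator G (generate G (g ` J))"
  shows "list_rk G g U = card J"
  unfolding list_rk_def list_span_def
  using assms generate.incl[of _ "g ` U" G] by (intro group_rank_generate_eq) blast+

text \<open>A maximal independent subfamily of \<open>C\<close> has \<open>list_rk G g C\<close>
  elements; if this number is \<open>card C\<close>, the subfamily is \<open>C\<close>
  itself.\<close>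

lemma (in comm_group) mat_indep_list_rk_iff:
  assumes "finite E" "g ` E \<subseteq> carrier G"
  shows "mat_indep E (list_rk G g) C \<longleftrightarrow> C \<subseteq> E \<and> independent_family G g C"
proof (cases "C \<subseteq> E")
  case True
  then have C: "finite C" "g ` C \<subseteq> carrier G" using assms finite_subset by auto
  have "independent_family G g C" if rk: "list_rk G g C = card C"
  proof -
    have "independent_family G g {}" by (simp add: independent_family_def)
    then obtain D where D: "D \<subseteq> C" "independent_family G g D"
      "g ` C \<subseteq> isolator G (generate G (g ` D))"
      using C by (elim independent_extension[of g "{}" C]) auto
    then have "card D = card C" using list_rk_basis[OF C D] rk by simp
    then have "D = C" using D(1) C(1) by (simp add: card_subset_eq)
    then show ?thesis using D by simp
  qed
  then show ?thesis using True list_rk_independent by (auto simp: mat_indep_def)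
qed (simp add: mat_indep_def)

text \<open>
  \<open>B\<close> extends a basis \<open>I\<close> of \<open>A\<close>. Since \<open>B\<close> is independent, an element of \<open>\<langle>\<L>\<^sub>B\<rangle>\<close> some multiple of
  which lies in \<open>\<langle>\<L>\<^sub>I\<rangle>\<close> lies itself in \<open>\<langle>\<L>\<^sub>I\<rangle>\<close>.
\<close>

lemma (in comm_group) adapted_basis:
  assumes "finite E" "g ` E \<subseteq> carrier G" "A \<subseteq> E"
  obtains B where "B \<in> list_bases G E g"
    "isolator G (list_span G g A) \<subseteq> isolator G (list_span G g B)"
    "isolator G (list_span G g A) \<inter> list_span G g B \<subseteq> list_span G g A"
proof -
  have A: "finite A" "g ` A \<subseteq> carrier G" using assms finite_subset by auto
  have "independent_family G g {}" by (simp add: independent_family_def)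
  then obtain I where I: "I \<subseteq> A" "independent_family G g I" "g ` A \<subseteq> isolator G (generate G (g ` I))"
    using A by (elim independent_extension[of g "{}" A]) auto
  obtain B where B: "I \<subseteq> B" "B \<subseteq> E" "independent_family G g B"
    "g ` E \<subseteq> isolator G (generate G (g ` B))"
    using I assms by (elim independent_extension[of g I E]) auto
  have Bfin: "finite B" "g ` B \<subseteq> carrier G" using B(3) by (auto simp: independent_family_def)
  have Ifin: "finite I" "g ` I \<subseteq> carrier G" using I(2) by (auto simp: independent_family_def)
  have genI: "subgroup (generate G (g ` I)) G" using Ifin(2) by (rule generate_is_subgroup)
  have IA: "generate G (g ` I) \<subseteq> generate G (g ` A)" using I(1) A by (intro mono_generate) auto
  have IB: "generate G (g ` I) \<subseteq> generate G (g ` B)" using B(1) Bfin by (intro mono_generate) auto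
  have AI: "generate G (g ` A) \<subseteq> isolator G (generate G (g ` I))"
    using genI I(3) by (rule generate_subset_isolator)
  have iso: "\<exists>n>0. a [^] (n::nat) \<in> generate G (g ` I)"
    if a: "a \<in> isolator G (list_span G g A)" for a
  proof -
    obtain n :: nat where n: "a \<in> carrier G" "n > 0" "a [^] n \<in> generate G (g ` A)"
      using a by (auto simp: isolator_def list_span_def)
    then obtain m :: nat where "m > 0" "(a [^] n) [^] m \<in> generate G (g ` I)"
      using AI by (auto simp: isolator_def)
    then show ?thesis using n by (auto simp: nat_pow_pow intro!: exI[of _ "n * m"])
  qed
  show thesis
  proof (rule that)
    show "B \<in> list_bases G E g"
      unfolding list_bases_def mat_bases_def mem_Collect_eq mat_indep_list_rk_iff[OF assms(1,2)]
    proof (intro conjI allI impI)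
      show "B \<subseteq> E" "independent_family G g B" by fact+
      fix C assume C: "(C \<subseteq> E \<and> independent_family G g C) \<and> B \<subseteq> C"
      \<comment> \<open>For maximality, \<open>C\<close> is extended to a full-rank
        \<open>C'\<close>. Both \<open>C'\<close> and \<open>B\<close> have size
        \<open>list_rk G g E\<close>, which forces \<open>B\<close>, \<open>C\<close> and
        \<open>C'\<close> to coincide.\<close>
      then have "independent_family G g C" "C \<subseteq> E" by auto
      then obtain C' where C': "C \<subseteq> C'" "C' \<subseteq> E" "independent_family G g C'"
        "g ` E \<subseteq> isolator G (generate G (g ` C'))"
        using assms by (elim independent_extension[of g C E]) auto
      have "card C' = card B"
        using list_rk_basis[OF assms(1,2) C'(2-4)] list_rk_basis[OF assms(1,2) B(2-4)] by simp
      moreover have "finite C'" using C'(2) assms(1) finite_subset by blast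
      ultimately have "B = C'" using C C'(1) by (intro card_subset_eq) auto
      then show "C = B" using C C'(1) by blast
    qed
    show "isolator G (list_span G g A) \<subseteq> isolator G (list_span G g B)"
      using iso IB by (fastforce simp: isolator_def list_span_def)
    show "isolator G (list_span G g A) \<inter> list_span G g B \<subseteq> list_span G g A"
    proof
      fix y assume y: "y \<in> isolator G (list_span G g A) \<inter> list_span G g B"
      then obtain c where c: "y = lincomb G g B c"
        using generate_eq_lincombs[OF Bfin] by (auto simp: list_span_def)
      obtain n :: nat where n: "n > 0" "y [^] n \<in> generate G (g ` I)" using iso y by blast
      then obtain d where d: "y [^] n = lincomb G g I d" using generate_eq_lincombs[OF Ifin] by auto
      \<comment> \<open>\<open>d\<close> extended by zero to \<open>B\<close>, so that coefficients
        can be compared over the independent family \<open>B\<close>; those of \<open>y\<close>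
        outside \<open>I\<close> must vanish.\<close>
      define d' where "d' = (\<lambda>j. if j \<in> I then d j else 0)"
      have "lincomb G g B (\<lambda>j. int n * c j) = y [^] n"
        using Bfin by (simp add: c lincomb_scale int_pow_int)
      also have "\<dots> = lincomb G g I d'"
        unfolding d using Ifin by (intro lincomb_cong) (auto simp: d'_def)
      also have "\<dots> = lincomb G g B d'"
        using Bfin B(1) by (intro lincomb_mono_neutral[symmetric]) (auto simp: d'_def)
      finally have eq: "lincomb G g B (\<lambda>j. int n * c j) = lincomb G g B d'" .
      have "c j = 0" if "j \<in> B - I" for j
        using independent_family_lincomb_inj[OF B(3) eq, of j] that n by (simp add: d'_def)
      then have "y = lincomb G g I c"
        unfolding c using Bfin B(1) by (intro lincomb_mono_neutral) auto
      then have "y \<in> generate G (g ` I)" using generate_eq_lincombs[OF Ifin] by simp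
      then show "y \<in> list_span G g A" using IA by (auto simp: list_span_def)
    qed
  qed
qed

section \<open>The q-torsion of the quotients for the two special classes of q\<close>

lemma (in comm_group) FactGroup_power_kernel:
  assumes "subgroup H G"
  shows "{Y \<in> carrier (G Mod H). Y [^]\<^bsub>G Mod H\<^esub> (q::nat) = \<one>\<^bsub>G Mod H\<^esub>}
       = (\<lambda>a. H #> a) ` {a \<in> carrier G. a [^] q \<in> H}"
  unfolding carrier_FactGroup using FactGroup_nat_pow_eq_one_iff[OF assms] by blast

text \<open>Suppose the \<open>q\<close>-multiple of \<open>a\<close> lies in the span of
  \<open>A\<close>. The m(B)-multiple of \<open>a\<close> lies in the span of the adapted basis
  \<open>B\<close>, hence in that of \<open>A\<close>. As \<open>q\<close> and m(B) are coprime,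
  Bezout puts \<open>a\<close> itself there.\<close>

lemma (in comm_group) card_power_kernel_ZM:
  assumes fg: "finitely_generated G" and E: "finite E" "g ` E \<subseteq> carrier G" and "A \<subseteq> E"
    and q: "q \<in> ZM_set G E g"
  defines "K \<equiv> G Mod list_span G g A"
  shows "card {Y \<in> carrier K. Y [^]\<^bsub>K\<^esub> q = \<one>\<^bsub>K\<^esub>} = 1"
proof -
  obtain B where B: "B \<in> list_bases G E g"
    "isolator G (list_span G g A) \<subseteq> isolator G (list_span G g B)"
    "isolator G (list_span G g A) \<inter> list_span G g B \<subseteq> list_span G g A"
    using adapted_basis[OF E \<open>A \<subseteq> E\<close>] by blast
  have BE: "B \<subseteq> E" using B(1) by (simp add: list_bases_def mat_bases_def mat_indep_def)
  have HA: "subgroup (list_span G g A) G" and HB: "subgroup (list_span G g B) G"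
    unfolding list_span_def using E \<open>A \<subseteq> E\<close> BE by (auto intro!: generate_is_subgroup)
  define m where "m = list_mult G g B"
  interpret Q: comm_group "G Mod list_span G g B" by (rule abelian_FactGroup[OF HB])
  have tors: "subgroup (list_torsion G g B) (G Mod list_span G g B)"
    unfolding list_torsion_def torsion_eq_isolator by (intro Q.subgroup_isolator Q.triv_subgroup)
  have fin: "finite (list_torsion G g B)"
    unfolding list_torsion_def by (intro Q.finite_torsion finitely_generated_FactGroup fg HB)
  interpret T: group "(G Mod list_span G g B)\<lparr>carrier := list_torsion G g B\<rparr>"
    by (rule Q.subgroup_imp_group[OF tors])
  \<comment> \<open>Lagrange in the torsion group of the quotient by the span of \<open>B\<close>,
    which has order \<open>m\<close>.\<close>
  have pow_m: "a [^] m \<in> list_span G g B" if a: "a \<in> isolator G (list_span G g B)" for a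
  proof -
    have aG: "a \<in> carrier G" using a by (simp add: isolator_def)
    have "list_span G g B #> a \<in> list_torsion G g B"
      using a by (simp add: list_torsion_def torsion_FactGroup[OF HB])
    then have "(list_span G g B #> a) [^]\<^bsub>G Mod list_span G g B\<^esub> m = \<one>\<^bsub>G Mod list_span G g B\<^esub>"
      using T.pow_order_eq_1[of "list_span G g B #> a"]
      by (simp add: order_def m_def list_mult_def flip: Q.nat_pow_consistent)
    then show ?thesis using FactGroup_nat_pow_eq_one_iff[OF HB aG] by blast
  qed
  have "m dvd Lcm (list_mult G g ` list_bases G E g)" unfolding m_def using B(1) by (intro dvd_Lcm) auto
  moreover have "coprime q (Lcm (list_mult G g ` list_bases G E g))" "q > 0"
    using q by (simp_all add: ZM_set_def coprime_iff_gcd_eq_1)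
  ultimately have "coprime (int q) (int m)" "q > 0"
    using coprime_divisors[of q q m] by auto
  then obtain u w where uw: "u * int q + w * int m = 1"
    using bezout_int[of "int q" "int m"] by auto
  have "a \<in> list_span G g A" if a: "a \<in> carrier G" "a [^] q \<in> list_span G g A" for a
  proof -
    have iso: "a \<in> isolator G (list_span G g A)" using a \<open>q > 0\<close> by (auto simp: isolator_def)
    then have "a [^] m \<in> isolator G (list_span G g A)"
      by (rule subgroup_nat_pow_closed[OF subgroup_isolator[OF HA]])
    moreover have "a [^] m \<in> list_span G g B" using iso B(2) pow_m by blast
    ultimately have am: "a [^] m \<in> list_span G g A" using B(3) by blast
    have "a = a [^] (int q * u + int m * w)" using uw a by (simp add: mult.commute)
    also have "\<dots> = (a [^] q) [^] u \<otimes> (a [^] m) [^] w"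
      using a by (simp add: int_pow_mult int_pow_pow flip: int_pow_int)
    also have "\<dots> \<in> list_span G g A"
      using a am HA by (simp add: subgroup.m_closed subgroup_int_pow_closed)
    finally show ?thesis .
  qed
  then have "{a \<in> carrier G. a [^] q \<in> list_span G g A} = list_span G g A"
    using subgroup.subset[OF HA] subgroup_nat_pow_closed[OF HA] by blast
  then have "{Y \<in> carrier K. Y [^]\<^bsub>K\<^esub> q = \<one>\<^bsub>K\<^esub>} = (\<lambda>a. list_span G g A #> a) ` list_span G g A"
    unfolding K_def by (simp only: FactGroup_power_kernel[OF HA])
  also have "\<dots> = {list_span G g A}"
    using r_coset_eq_self_iff[OF HA] subgroup.subset[OF HA] subgroup.one_closed[OF HA] by blast
  finally show ?thesis by simp
qed

text \<open>For \<open>a\<close> in the isolator of the span of \<open>A\<close>, the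
  \<open>q\<close>-multiple lies in the span of the adapted basis \<open>B\<close> because
  \<open>q\<close> kills the torsion there, and so it lies in the span of \<open>A\<close>. Thus the
  \<open>q\<close>-torsion of \<open>K\<close> is its whole torsion.\<close>

lemma (in comm_group) card_power_kernel_ZA:
  assumes E: "finite E" "g ` E \<subseteq> carrier G" and "A \<subseteq> E" and q: "q \<in> ZA_set G E g"
  defines "K \<equiv> G Mod list_span G g A"
  shows "card {Y \<in> carrier K. Y [^]\<^bsub>K\<^esub> q = \<one>\<^bsub>K\<^esub>} = list_mult G g A"
proof -
  obtain B where B: "B \<in> list_bases G E g"
    "isolator G (list_span G g A) \<subseteq> isolator G (list_span G g B)"
    "isolator G (list_span G g A) \<inter> list_span G g B \<subseteq> list_span G g A"
    using adapted_basis[OF E \<open>A \<subseteq> E\<close>] by blast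
  have BE: "B \<subseteq> E" using B(1) by (simp add: list_bases_def mat_bases_def mat_indep_def)
  have HA: "subgroup (list_span G g A) G" and HB: "subgroup (list_span G g B) G"
    unfolding list_span_def using E \<open>A \<subseteq> E\<close> BE by (auto intro!: generate_is_subgroup)
  have "q > 0" and mult: "multiples (G Mod list_span G g B) q (list_torsion G g B)
      = {\<one>\<^bsub>G Mod list_span G g B\<^esub>}"
    using q B(1) by (auto simp: ZA_set_def)
  have "a [^] q \<in> list_span G g A" if a: "a \<in> isolator G (list_span G g A)" for a
  proof -
    have aB: "a \<in> isolator G (list_span G g B)" using a B(2) by blast
    then have aG: "a \<in> carrier G" by (simp add: isolator_def)
    have "list_span G g B #> a \<in> list_torsion G g B"
      using aB by (simp add: list_torsion_def torsion_FactGroup[OF HB])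
    then have "(list_span G g B #> a) [^]\<^bsub>G Mod list_span G g B\<^esub> q = \<one>\<^bsub>G Mod list_span G g B\<^esub>"
      using mult unfolding multiples_def by blast
    then have "a [^] q \<in> list_span G g B" using FactGroup_nat_pow_eq_one_iff[OF HB aG] by blast
    moreover have "a [^] q \<in> isolator G (list_span G g A)"
      using a by (rule subgroup_nat_pow_closed[OF subgroup_isolator[OF HA]])
    ultimately show ?thesis using B(3) by blast
  qed
  then have "{a \<in> carrier G. a [^] q \<in> list_span G g A} = isolator G (list_span G g A)"
    using \<open>q > 0\<close> unfolding isolator_def by blast
  then show ?thesis
    unfolding K_def list_mult_def list_torsion_def
    by (simp only: FactGroup_power_kernel[OF HA] torsion_FactGroup[OF HA])
qed

section \<open>The polynomials\<close>

text \<open>Multiply out over subsets of \<open>E\<close> and exchange the sums; the term of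
  \<open>A\<close> survives for those \<open>\<phi>\<close> that satisfy \<open>P\<close> throughout
  \<open>A\<close>.\<close>

lemma sum_prod_of_bool_expand:
  fixes v :: "'e \<Rightarrow> 'k::field_char_0"
  assumes "finite E" "finite K"
  shows "(\<Sum>\<phi>\<in>K. \<Prod>e\<in>E. 1 + v e * of_bool (P \<phi> e))
       = (\<Sum>A\<in>Pow E. (\<Prod>e\<in>A. v e) * of_nat (card {\<phi> \<in> K. \<forall>e\<in>A. P \<phi> e}))"
proof -
  have "(\<Prod>e\<in>E. 1 + v e * of_bool (P \<phi> e)) = (\<Sum>A\<in>Pow E. (\<Prod>e\<in>A. v e) * of_bool (\<forall>e\<in>A. P \<phi> e))"
    for \<phi>
  proof -
    have "(\<Prod>e\<in>E. v e * of_bool (P \<phi> e) + 1)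
        = (\<Sum>A\<in>Pow E. (\<Prod>e\<in>A. v e * of_bool (P \<phi> e)) * (\<Prod>e\<in>E - A. 1))"
      using assms(1) by (rule prod_add)
    also have "\<dots> = (\<Sum>A\<in>Pow E. (\<Prod>e\<in>A. v e) * of_bool (\<forall>e\<in>A. P \<phi> e))"
    proof (intro sum.cong refl)
      fix A assume "A \<in> Pow E"
      then have "finite A" using assms(1) finite_subset by auto
      then have "(\<Prod>e\<in>A. of_bool (P \<phi> e) :: 'k) = of_bool (\<forall>e\<in>A. P \<phi> e)"
        by (induction A rule: finite_induct) auto
      then show "(\<Prod>e\<in>A. v e * of_bool (P \<phi> e)) * (\<Prod>e\<in>E - A. 1) = (\<Prod>e\<in>A. v e) * of_bool (\<forall>e\<in>A. P \<phi> e)"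
        by (simp add: prod.distrib)
    qed
    finally show ?thesis by (simp only: add.commute)
  qed
  then have "(\<Sum>\<phi>\<in>K. \<Prod>e\<in>E. 1 + v e * of_bool (P \<phi> e))
      = (\<Sum>\<phi>\<in>K. \<Sum>A\<in>Pow E. (\<Prod>e\<in>A. v e) * of_bool (\<forall>e\<in>A. P \<phi> e))"
    by (simp only:)
  also have "\<dots> = (\<Sum>A\<in>Pow E. \<Sum>\<phi>\<in>K. (\<Prod>e\<in>A. v e) * of_bool (\<forall>e\<in>A. P \<phi> e))"
    by (rule sum.swap)
  also have "\<dots> = (\<Sum>A\<in>Pow E. (\<Prod>e\<in>A. v e) * of_nat (card {\<phi> \<in> K. \<forall>e\<in>A. P \<phi> e}))"
  proof (intro sum.cong refl)
    fix A
    have "(\<Sum>\<phi>\<in>K. of_bool (\<forall>e\<in>A. P \<phi> e) :: 'k) = of_nat (card {\<phi> \<in> K. \<forall>e\<in>A. P \<phi> e})"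
      using assms(2) by (simp add: of_bool_def flip: sum.inter_filter)
    then show "(\<Sum>\<phi>\<in>K. (\<Prod>e\<in>A. v e) * of_bool (\<forall>e\<in>A. P \<phi> e))
        = (\<Prod>e\<in>A. v e) * of_nat (card {\<phi> \<in> K. \<forall>e\<in>A. P \<phi> e})"
      by (simp add: sum_distrib_left[symmetric])
  qed
  finally show ?thesis .
qed

text \<open>Restriction to \<open>A\<close> and extension by zero are mutually inverse.\<close>

lemma (in comm_group) card_relations_supported:
  assumes E: "finite E" "x ` E \<subseteq> carrier G" and "A \<subseteq> E" and "q > 0"
  shows "card {c \<in> \<Pi>\<^sub>E j\<in>E. {0..<int q}. lincomb G x E c \<in> H \<and> (\<forall>e\<in>E - A. c e = 0)}
       = card {c \<in> \<Pi>\<^sub>E j\<in>A. {0..<int q}. lincomb G x A c \<in> H}"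
proof -
  let ?X = "{c \<in> \<Pi>\<^sub>E j\<in>E. {0..<int q}. lincomb G x E c \<in> H \<and> (\<forall>e\<in>E - A. c e = 0)}"
  let ?Y = "{c \<in> \<Pi>\<^sub>E j\<in>A. {0..<int q}. lincomb G x A c \<in> H}"
  let ?f = "\<lambda>c. restrict c A" and ?h = "\<lambda>c. \<lambda>e\<in>E. if e \<in> A then c e else (0::int)"
  have A: "finite A" "x ` A \<subseteq> carrier G" using assms finite_subset by auto
  have lc: "lincomb G x E c = lincomb G x A d"
    if "\<And>e. e \<in> E - A \<Longrightarrow> c e = 0" "\<And>e. e \<in> A \<Longrightarrow> c e = d e" for c d
  proof -
    have "lincomb G x E c = lincomb G x A c" using E \<open>A \<subseteq> E\<close> that by (intro lincomb_mono_neutral) auto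
    also have "\<dots> = lincomb G x A d" using A that by (intro lincomb_cong) auto
    finally show ?thesis .
  qed
  have "bij_betw ?f ?X ?Y"
  proof (rule bij_betw_byWitness[where f'="?h"])
    show "\<forall>c\<in>?X. ?h (?f c) = c"
    proof (intro ballI ext)
      fix c e assume "c \<in> ?X"
      then show "?h (?f c) e = c e" using \<open>A \<subseteq> E\<close> by (auto simp: PiE_iff extensional_def)
    qed
    show "\<forall>c\<in>?Y. ?f (?h c) = c"
    proof (intro ballI ext)
      fix c e assume "c \<in> ?Y"
      then show "?f (?h c) e = c e" using \<open>A \<subseteq> E\<close> by (auto simp: PiE_iff extensional_def)
    qed
    show "?f ` ?X \<subseteq> ?Y"
    proof (rule image_subsetI)
      fix c assume c: "c \<in> ?X"
      then have "?f c \<in> (\<Pi>\<^sub>E j\<in>A. {0..<int q})" using \<open>A \<subseteq> E\<close> by (auto simp: PiE_iff)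
      moreover have "lincomb G x A (?f c) \<in> H" using c lc[of c "?f c"] by simp
      ultimately show "?f c \<in> ?Y" by blast
    qed
    show "?h ` ?Y \<subseteq> ?X"
    proof (rule image_subsetI)
      fix c assume c: "c \<in> ?Y"
      then have "?h c \<in> (\<Pi>\<^sub>E j\<in>E. {0..<int q})" using \<open>q > 0\<close> by (auto simp: PiE_iff)
      moreover have "lincomb G x E (?h c) = lincomb G x A c" using \<open>A \<subseteq> E\<close> by (intro lc) auto
      ultimately show "?h c \<in> ?X" using c by auto
    qed
  qed
  then show ?thesis by (rule bij_betw_same_card)
qed

theorem theorem8p1:
  fixes G :: "('g, 'b) monoid_scheme"
    and E :: "'e set"
    and g :: "'e \<Rightarrow> 'g"
    and q :: nat
    and v :: "'e \<Rightarrow> 'k::field_char_0"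
  assumes "comm_group G"
    and "finitely_generated G"
    and "finite E"
    and "\<And>e. e \<in> E \<Longrightarrow> g e \<in> carrier G"
    and "q > 0"
    and "\<And>e. e \<in> E \<Longrightarrow> v e \<noteq> 0"
  shows "flow_poly G E g q v =
           of_nat q powi (- int (group_rank G (carrier G)))
           * (of_nat (card (multiples G q (torsion G))) / of_nat (list_mult G g {}))
           * (\<Prod>e\<in>E. v e) * Z_Potts G E g q (\<lambda>e. of_nat q / v e)
       \<and> (q \<in> ZM_set G E g \<longrightarrow>
           flow_poly G E g q v =
             (\<Prod>e\<in>E. v e) * Z_matroid E (list_rk G g) (of_nat q) (\<lambda>e. of_nat q / v e))
       \<and> (q \<in> ZA_set G E g \<longrightarrow>
           flow_poly G E g q v =
             1 / of_nat (list_mult G g {})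
             * (\<Prod>e\<in>E. v e)
             * Z_arith_matroid E (list_rk G g) (list_mult G g) (of_nat q) (\<lambda>e. of_nat q / v e))"
proof -
  interpret comm_group G by fact
  note fg = \<open>finitely_generated G\<close> and finE = \<open>finite E\<close> and q = \<open>q > 0\<close>
  have gE: "g ` E \<subseteq> carrier G" using assms(4) by blast
  define qG where "qG = multiples G q (carrier G)"
  define r where "r = group_rank G (carrier G)"
  \<comment> \<open>\<open>i0\<close> is [G : qG] and \<open>t0\<close> is |G[q]|;
    \<open>W A\<close>, \<open>i A\<close> and \<open>t A\<close> count the flows supported on
    \<open>A\<close>, the cosets of the span of \<open>A\<close> plus qG, and the
    \<open>q\<close>-torsion of the quotient by the span of \<open>A\<close>.\<close>
  define i0 where "i0 = card (carrier (G Mod qG))"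
  define t0 where "t0 = card {a \<in> carrier G. a [^]\<^bsub>G\<^esub> q = \<one>\<^bsub>G\<^esub>}"
  define W where "W A = card {c \<in> \<Pi>\<^sub>E j\<in>A. {0..<int q}. lincomb G g A c \<in> qG}" for A
  define i where "i A = card (carrier (G Mod plus_multiples G (list_span G g A) q))" for A
  define t where "t A = card {Y \<in> carrier (G Mod list_span G g A).
      Y [^]\<^bsub>G Mod list_span G g A\<^esub> q = \<one>\<^bsub>G Mod list_span G g A\<^esub>}" for A
  define m where "m = list_mult G g"
  define V where "V = (\<Prod>e\<in>E. v e)"
  define cv where "cv A = (\<Prod>e\<in>E - A. v e)" for A
  have qG: "subgroup qG G" unfolding qG_def by (rule subgroup_multiples[OF subgroup_self])
  have qk: "(of_nat q :: 'k) \<noteq> 0" using q by simp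

  have fin_sub: "finite A" "g ` A \<subseteq> carrier G" if "A \<subseteq> E" for A
    using that finE gE finite_subset by auto
  have Wi: "W A * i0 = q ^ card A * i A" if "A \<subseteq> E" for A
    unfolding W_def i_def i0_def qG_def list_span_def
    using card_relations_mod_multiples[OF fg fin_sub[OF that] q] .
  have it: "i A * q ^ list_rk G g A = q ^ r * t A" if "A \<subseteq> E" for A
    unfolding i_def t_def r_def list_span_def list_rk_def
    using card_FactGroup_Mod_multiples[OF fg fin_sub[OF that] q]
      card_Mod_plus_multiples[OF generate_is_subgroup[OF fin_sub(2)[OF that]]] by simp
  have i0: "i0 = q ^ r * t0"
    unfolding i0_def qG_def r_def t0_def by (rule card_Mod_multiples_rank[OF fg q])
  have t0: "t0 > 0"
    unfolding t0_def using finite_power_kernel[OF fg q] by (auto simp: card_gt_0_iff intro!: exI[of _ "\<one>\<^bsub>G\<^esub>"])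
  have i0_pos: "i0 > 0" using i0 t0 q by simp
  have m0: "m {} = t0 * card (multiples G q (torsion G))"
    unfolding m_def list_mult_empty t0_def by (rule card_torsion_eq[OF fg q])
  have m0_pos: "m {} > 0"
    unfolding m_def list_mult_empty using finite_torsion[OF fg]
    by (auto simp: card_gt_0_iff torsion_def intro!: exI[of _ "\<one>\<^bsub>G\<^esub>"] exI[of _ 1])
  have W0: "W {} = 1"
    unfolding W_def using subgroup.one_closed[OF qG] by (simp add: lincomb_def)
  have rk0: "list_rk G g {} = 0"
    using list_rk_independent[of g "{}"] by (simp add: independent_family_def)
  \<comment> \<open>Read off numerically: \<open>W {} = 1\<close> gives \<open>i {} = i0\<close>,
    and \<open>q ^ r\<close> cancels. This avoids identifying \<open>G\<close> with its quotient by
    the trivial subgroup.\<close>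
  have t0_eq: "t {} = t0" using Wi[of "{}"] it[of "{}"] i0 W0 rk0 q by simp
  \<comment> \<open>Eliminating \<open>i A\<close> and \<open>i0\<close> cancels
    \<open>q ^ r\<close>, leaving \<open>W A\<close> in terms of the rank of \<open>A\<close> and
    torsion counts only.\<close>
  have Wt: "of_nat (W A) = (of_nat q :: 'k) ^ card A * of_nat (t A) / (of_nat t0 * of_nat q ^ list_rk G g A)"
    if A: "A \<subseteq> E" for A
  proof -
    have "q ^ r * (W A * t0 * q ^ list_rk G g A) = W A * i0 * q ^ list_rk G g A"
      by (simp add: i0)
    also have "\<dots> = q ^ r * (q ^ card A * t A)" using Wi[OF A] it[OF A] by simp
    finally have "W A * t0 * q ^ list_rk G g A = q ^ card A * t A" using q by simp
    then have "(of_nat (W A) * of_nat t0 * of_nat q ^ list_rk G g A :: 'k) = of_nat q ^ card A * of_nat (t A)"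
      by (metis of_nat_mult of_nat_power)
    then show ?thesis using t0 qk by (simp add: field_simps)
  qed
  have scale: "V * (\<Prod>e\<in>A. of_nat q / v e) = of_nat q ^ card A * cv A" if A: "A \<subseteq> E" for A
  proof -
    have "V = cv A * (\<Prod>e\<in>A. v e)" unfolding V_def cv_def using A finE by (rule prod.subset_diff)
    moreover have "(\<Prod>e\<in>A. v e) \<noteq> 0" using A assms(6) fin_sub(1)[OF A] by auto
    ultimately show ?thesis by (simp add: prod_dividef)
  qed

  have flow: "flow_poly G E g q v = (\<Sum>A\<in>Pow E. cv A * of_nat (W A))"
  proof -
    define K where "K = {c \<in> \<Pi>\<^sub>E j\<in>E. {0..<int q}. lincomb G g E c \<in> qG}"
    have "Psi G E g q c = qG #>\<^bsub>G\<^esub> lincomb G g E c" for c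
      by (simp add: Psi_def qG_def lincomb_def)
    then have "kernel (product_group E (\<lambda>_. integer_mod_group q)) (G Mod qG) (Psi G E g q) = K"
      unfolding K_def kernel_def using q gE
      by (simp add: carrier_integer_mod_group r_coset_eq_self_iff[OF qG])
    then have "flow_poly G E g q v = (\<Sum>\<phi>\<in>K. \<Prod>e\<in>E. 1 + v e * of_bool (\<phi> e = 0))"
      by (simp add: flow_poly_def qG_def)
    also have "\<dots> = (\<Sum>A\<in>Pow E. (\<Prod>e\<in>A. v e) * of_nat (card {\<phi> \<in> K. \<forall>e\<in>A. \<phi> e = 0}))"
      using finE finite_PiE[OF finE, of "\<lambda>_. {0..<int q}"]
      by (intro sum_prod_of_bool_expand) (auto simp: K_def)
    \<comment> \<open>Passing to complements turns flows vanishing on a set into flows supported on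
      \<open>A\<close>; this is where the product over \<open>E - A\<close> in \<open>cv\<close>
      comes from.\<close>
    also have "\<dots> = (\<Sum>A\<in>Pow E. cv A * of_nat (card {\<phi> \<in> K. \<forall>e\<in>E - A. \<phi> e = 0}))"
      unfolding cv_def
      by (rule sum.reindex_bij_witness[of _ "\<lambda>A. E - A" "\<lambda>A. E - A"]) (auto simp: double_diff)
    also have "\<dots> = (\<Sum>A\<in>Pow E. cv A * of_nat (W A))"
      using card_relations_supported[OF finE gE _ q, of _ qG] by (simp add: K_def W_def conj_assoc)
    finally show ?thesis .
  qed

  have potts: "Z_Potts G E g q u = (\<Sum>A\<in>Pow E. (\<Prod>e\<in>A. u e) * of_nat (i A))" for u :: "'e \<Rightarrow> 'k"
  proof -
    have hom: "card {\<phi> \<in> Hom_set G (integer_mod_group q). \<forall>e\<in>A. \<phi> (g e) = 0} = i A" if "A \<subseteq> E" for A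
      unfolding i_def list_span_def using card_Hom_vanishing[OF fg fin_sub(2)[OF that] q] .
    have "i {} = i0" using Wi[of "{}"] W0 by simp
    \<comment> \<open>Finiteness is read off from the count: infinite sets have cardinality 0,
      whereas \<open>i0\<close> is positive.\<close>
    then have "card (Hom_set G (integer_mod_group q)) > 0" using hom[of "{}"] i0_pos by simp
    then have "finite (Hom_set G (integer_mod_group q))" by (simp add: card_gt_0_iff)
    then have "Z_Potts G E g q u = (\<Sum>A\<in>Pow E. (\<Prod>e\<in>A. u e) *
        of_nat (card {\<phi> \<in> Hom_set G (integer_mod_group q). \<forall>e\<in>A. \<phi> (g e) = 0}))"
      unfolding Z_Potts_def by (rule sum_prod_of_bool_expand[OF finE])
    then show ?thesis using hom by simp
  qed

  \<comment> \<open>Term by term: \<open>scale\<close> turns the weights of \<open>A\<close> into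
    \<open>cv A\<close> times q^|A|, and \<open>Wi\<close> trades q^|A| \<open>i A\<close> for
    \<open>i0\<close> times \<open>W A\<close>.\<close>
  have "V * Z_Potts G E g q (\<lambda>e. of_nat q / v e) = of_nat i0 * flow_poly G E g q v"
    unfolding potts flow sum_distrib_left
  proof (intro sum.cong refl)
    fix A assume "A \<in> Pow E"
    then have A: "A \<subseteq> E" by simp
    have "V * ((\<Prod>e\<in>A. of_nat q / v e) * of_nat (i A)) = cv A * of_nat (q ^ card A * i A)"
      using scale[OF A] by (simp flip: mult.assoc)
    also have "\<dots> = of_nat i0 * (cv A * of_nat (W A))" unfolding Wi[OF A, symmetric] by simp
    finally show "V * ((\<Prod>e\<in>A. of_nat q / v e) * of_nat (i A)) = of_nat i0 * (cv A * of_nat (W A))" .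
  qed
  \<comment> \<open>The prefactor is 1/[G : qG]: the index is q^r |G[q]|, and m of the empty set is
    |G[q]| times the order of the group of \<open>q\<close>-multiples of the torsion.\<close>
  moreover have "of_nat q powi (- int r) * (of_nat (card (multiples G q (torsion G))) / of_nat (m {}))
      = (1 / of_nat i0 :: 'k)"
    using m0 m0_pos qk t0 by (simp add: i0 power_int_minus field_simps)
  ultimately have part0: "flow_poly G E g q v = of_nat q powi (- int r)
      * (of_nat (card (multiples G q (torsion G))) / of_nat (m {})) * V
      * Z_Potts G E g q (\<lambda>e. of_nat q / v e)"
    using i0_pos by (simp add: mult.assoc)

  \<comment> \<open>All torsion counts are 1, so \<open>W A\<close> is q^(|A| - rk(A)).\<close>
  have part1: "flow_poly G E g q v = V * Z_matroid E (list_rk G g) (of_nat q) (\<lambda>e. of_nat q / v e)"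
    if ZM: "q \<in> ZM_set G E g"
  proof -
    have t1: "t A = 1" if "A \<subseteq> E" for A
      unfolding t_def by (rule card_power_kernel_ZM[OF fg finE gE that ZM])
    have "t0 = 1" using t1[of "{}"] t0_eq by simp
    show ?thesis
      unfolding flow Z_matroid_def sum_distrib_left
    proof (intro sum.cong refl)
      fix A assume "A \<in> Pow E"
      then have A: "A \<subseteq> E" by simp
      have "V * (of_nat q powi - int (list_rk G g A) * (\<Prod>e\<in>A. of_nat q / v e))
          = of_nat q powi - int (list_rk G g A) * (of_nat q ^ card A * cv A)"
        using scale[OF A] by (simp add: mult.left_commute)
      also have "\<dots> = cv A * of_nat (W A)"
        using qk by (simp add: Wt[OF A] t1[OF A] \<open>t0 = 1\<close> power_int_minus field_simps)
      finally show "cv A * of_nat (W A)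
          = V * (of_nat q powi - int (list_rk G g A) * (\<Prod>e\<in>A. of_nat q / v e))" by simp
    qed
  qed

  \<comment> \<open>Here \<open>t A = m A\<close> and \<open>t0 = m {}\<close>, so
    \<open>W A\<close> acquires the factor m(A)/m({}).\<close>
  have part2: "flow_poly G E g q v = 1 / of_nat (m {}) * V
      * Z_arith_matroid E (list_rk G g) m (of_nat q) (\<lambda>e. of_nat q / v e)"
    if ZA: "q \<in> ZA_set G E g"
  proof -
    have tm: "t A = m A" if "A \<subseteq> E" for A
      unfolding t_def m_def by (rule card_power_kernel_ZA[OF finE gE that ZA])
    have "t0 = m {}" using tm[of "{}"] t0_eq by simp
    show ?thesis
      unfolding flow Z_arith_matroid_def sum_distrib_left
    proof (intro sum.cong refl)
      fix A assume "A \<in> Pow E"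
      then have A: "A \<subseteq> E" by simp
      have "1 / of_nat (m {}) * V * (of_nat (m A) * of_nat q powi - int (list_rk G g A)
            * (\<Prod>e\<in>A. of_nat q / v e))
          = 1 / of_nat (m {}) * of_nat (m A) * of_nat q powi - int (list_rk G g A)
            * (of_nat q ^ card A * cv A)"
        unfolding scale[OF A, symmetric] by (simp only: mult_ac)
      also have "\<dots> = cv A * of_nat (W A)"
        using qk m0_pos by (simp add: Wt[OF A] tm[OF A] \<open>t0 = m {}\<close> power_int_minus field_simps)
      finally show "cv A * of_nat (W A) = 1 / of_nat (m {}) * V
          * (of_nat (m A) * of_nat q powi - int (list_rk G g A) * (\<Prod>e\<in>A. of_nat q / v e))" by simp
    qed
  qed
  show ?thesis
    using part0 part1 part2 unfolding r_def m_def V_def by blast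
qed

end
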